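(* Let $(A,\alpha)$ be a unital C*-dynamical system of multiplicity $d$. (i) Suppose that $\beta < \log d$. Then $\mathcal{T}(A,\alpha)$ has no $(\sigma,\beta)$-KMS states. (ii) Suppose that $\beta \geq \log d$ and $\beta > 0$. Then a state $\psi$ of $\mathcal{T}(A,\alpha)$ is a $(\sigma,\beta)$-KMS state if and only if $\psi|_A$ is tracial and $$\psi(V_\mu a V_\nu^* ) = \delta_{\mu,\nu}\, e^{-|\mu|\beta}\, \psi(a) \quad \text{for all } a \in A \text{ and } \mu,\nu \in \mathbb{F}_+^d.$$
   Context: A unital C*-dynamical system $(A,\alpha)$ of multiplicity $d$ (with $1 \le d < \infty$) consists of a unital C*-algebra $A$ and $d$ unital $*$-endomorphisms $\alpha_1,\dots,\alpha_d$ of $A$. $\mathbb{F}_+^d$ is the free semigroup (monoid) of words on $d$ symbols, with empty word $\emptyset$; $|\mu|$ is the length of $\mu$. $\mathcal{T}(A,\alpha)$ (the Toeplitz-Pimsner algebra) is the universal C*-algebra generated by $A$ and elements $V_1,\dots,V_d$ such that $[V_1,\dots,V_d]$ is a row isometry ($V_i^*V_j = \delta_{i,j}1$) and $aV_i = V_i\alpha_i(a)$ for all $a\in A$, $i=1,\dots,d$. The algebra $A$ embeds in it isometrically and the unit of $A$ is its unit. For a word $\mu=\mu_n\cdots\mu_1$ write $V_\mu = V_{\mu_n}\cdots V_{\mu_1}$, with $V_\emptyset = 1$. The elements $V_\mu a V_\nu^*$ span a dense $*$-subalgebra. The gauge action $\{\gamma_z\}_{z\in\mathbb{T}}$ satisfies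 $\gamma_z(a)=a$, $\gamma_z(V_i)=zV_i$, and $\sigma:\mathbb{R}\to \mathrm{Aut}(\mathcal{T}(A,\alpha))$ is $\sigma_t=\gamma_{e^{it}}$, so $\sigma_t(V_\mu aV_\nu^* )=e^{i(|\mu|-|\nu|)t}V_\mu aV_\nu^*$. For $\beta\in\mathbb{R}$, a state $\psi$ on a C*-algebra $B$ with an action $\sigma$ of $\mathbb{R}$ is a $(\sigma,\beta)$-KMS state if $\psi(xy)=\psi(y\sigma_{i\beta}(x))$ for all $x,y$ in a norm-dense $\sigma$-invariant $*$-subalgebra of the analytic elements of $B$ (elements $x$ for which $t\mapsto\sigma_t(x)$ extends to an entire function $z\mapsto\sigma_z(x)$). *)

theory Defs
  imports "HOL-Analysis.Analysis" "HOL-Algebra.Ring"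
begin

subsection \<open>Unital C*-algebras\<close>

text \<open>A nonzero unital C*-algebra carried by a whole type. The class \<open>real_normed_algebra_1\<close>
  only knows the real scalars, so complex scalars and the involution are added.\<close>

class cstar_algebra = real_normed_algebra_1 + banach +
  fixes scaleC :: "complex \<Rightarrow> 'a \<Rightarrow> 'a"  (infixr \<open>*\<^sub>C\<close> 75)
    and star :: "'a \<Rightarrow> 'a"
  assumes scaleC_add_right: "c *\<^sub>C (x + y) = c *\<^sub>C x + c *\<^sub>C y"
    and scaleC_add_left: "(b + c) *\<^sub>C x = b *\<^sub>C x + c *\<^sub>C x"
    and scaleC_scaleC: "b *\<^sub>C (c *\<^sub>C x) = (b * c) *\<^sub>C x"
    and scaleC_of_real: "complex_of_real r *\<^sub>C x = r *\<^sub>R x"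
    and scaleC_mult_left: "(c *\<^sub>C x) * y = c *\<^sub>C (x * y)"
    and scaleC_mult_right: "x * (c *\<^sub>C y) = c *\<^sub>C (x * y)"
    and norm_scaleC: "norm (c *\<^sub>C x) = cmod c * norm x"
    and star_star: "star (star x) = x"
    and star_add: "star (x + y) = star x + star y"
    and star_scaleC: "star (c *\<^sub>C x) = cnj c *\<^sub>C star x"
    and star_mult: "star (x * y) = star y * star x"
    and norm_star_mult_self: "norm (star x * x) = (norm x)\<^sup>2"

text \<open>A unital C*-algebra carried by an arbitrary subset of a type. This version is needed for the
  universal property below, which quantifies over all C*-algebras and not over a single
  instance of the type class.\<close>

record 'c cstar_struct = "'c ring" +
  scal :: "complex \<Rightarrow> 'c \<Rightarrow> 'c"
  adj :: "'c \<Rightarrow> 'c"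
  nrm :: "'c \<Rightarrow> real"

locale cstar_structure = ring C for C :: "'c cstar_struct" (structure) +
  assumes scal_closed: "x \<in> carrier C \<Longrightarrow> scal C c x \<in> carrier C"
    and scal_add_right: "x \<in> carrier C \<Longrightarrow> y \<in> carrier C \<Longrightarrow>
          scal C c (x \<oplus> y) = scal C c x \<oplus> scal C c y"
    and scal_add_left: "x \<in> carrier C \<Longrightarrow> scal C (b + c) x = scal C b x \<oplus> scal C c x"
    and scal_scal: "x \<in> carrier C \<Longrightarrow> scal C b (scal C c x) = scal C (b * c) x"
    and scal_one: "x \<in> carrier C \<Longrightarrow> scal C 1 x = x"
    and scal_mult_left: "x \<in> carrier C \<Longrightarrow> y \<in> carrier C \<Longrightarrow>
          scal C c x \<otimes> y = scal C c (x \<otimes> y)"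
    and scal_mult_right: "x \<in> carrier C \<Longrightarrow> y \<in> carrier C \<Longrightarrow>
          x \<otimes> scal C c y = scal C c (x \<otimes> y)"
    and adj_closed: "x \<in> carrier C \<Longrightarrow> adj C x \<in> carrier C"
    and adj_adj: "x \<in> carrier C \<Longrightarrow> adj C (adj C x) = x"
    and adj_add: "x \<in> carrier C \<Longrightarrow> y \<in> carrier C \<Longrightarrow> adj C (x \<oplus> y) = adj C x \<oplus> adj C y"
    and adj_scal: "x \<in> carrier C \<Longrightarrow> adj C (scal C c x) = scal C (cnj c) (adj C x)"
    and adj_mult: "x \<in> carrier C \<Longrightarrow> y \<in> carrier C \<Longrightarrow> adj C (x \<otimes> y) = adj C y \<otimes> adj C x"
    and nrm_eq_0: "x \<in> carrier C \<Longrightarrow> nrm C x = 0 \<longleftrightarrow> x = \<zero>"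
    and nrm_triangle: "x \<in> carrier C \<Longrightarrow> y \<in> carrier C \<Longrightarrow> nrm C (x \<oplus> y) \<le> nrm C x + nrm C y"
    and nrm_scal: "x \<in> carrier C \<Longrightarrow> nrm C (scal C c x) = cmod c * nrm C x"
    and nrm_mult: "x \<in> carrier C \<Longrightarrow> y \<in> carrier C \<Longrightarrow> nrm C (x \<otimes> y) \<le> nrm C x * nrm C y"
    and nrm_adj_mult_self: "x \<in> carrier C \<Longrightarrow> nrm C (adj C x \<otimes> x) = (nrm C x)\<^sup>2"
    and complete: "(\<And>n. X n \<in> carrier C) \<Longrightarrow>
          (\<And>e. e > 0 \<Longrightarrow> \<exists>N. \<forall>m\<ge>N. \<forall>n\<ge>N. nrm C (X m \<ominus> X n) < e) \<Longrightarrow>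
          \<exists>x\<in>carrier C. (\<lambda>n. nrm C (X n \<ominus> x)) \<longlonglongrightarrow> 0"

definition cstar_of_type :: "'b::cstar_algebra cstar_struct" where
  "cstar_of_type = \<lparr>carrier = UNIV, mult = (*), one = 1, zero = 0, add = (+),
     scal = scaleC, adj = star, nrm = norm\<rparr>"

lemma cstar_structure_cstar_of_type: "cstar_structure (cstar_of_type :: 'b::cstar_algebra cstar_struct)"
proof -
  let ?C = "cstar_of_type :: 'b cstar_struct"
  have R: "ring ?C"
    by unfold_locales
      (auto simp: cstar_of_type_def Units_def algebra_simps intro: exI[of _ "- _"])
  interpret ring ?C by (rule R)
  have neg: "\<ominus>\<^bsub>?C\<^esub> x = - x" for x :: 'b
    by (rule minus_equality) (auto simp: cstar_of_type_def)
  have minus: "x \<ominus>\<^bsub>?C\<^esub> y = x - y" for x y :: 'b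
    unfolding a_minus_def neg by (simp add: cstar_of_type_def)
  have one: "(1::complex) *\<^sub>C x = x" for x :: 'b
    using scaleC_of_real[of 1 x] by simp
  have compl: "\<exists>x\<in>carrier ?C. (\<lambda>n. nrm ?C (X n \<ominus>\<^bsub>?C\<^esub> x)) \<longlonglongrightarrow> 0"
    if "\<And>e. e > 0 \<Longrightarrow> \<exists>N. \<forall>m\<ge>N. \<forall>n\<ge>N. nrm ?C (X m \<ominus>\<^bsub>?C\<^esub> X n) < e" for X :: "nat \<Rightarrow> 'b"
  proof -
    have "Cauchy X"
      using that unfolding Cauchy_def minus by (auto simp: cstar_of_type_def dist_norm)
    then obtain x where "X \<longlonglongrightarrow> x" by (auto simp: Cauchy_convergent_iff convergent_def)
    then have "(\<lambda>n. norm (X n - x)) \<longlonglongrightarrow> 0"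
      by (simp add: LIM_zero tendsto_norm_zero)
    then show ?thesis unfolding minus by (auto simp: cstar_of_type_def)
  qed
  show ?thesis
    by unfold_locales
      (use compl in \<open>auto simp: cstar_of_type_def one scaleC_add_right scaleC_add_left scaleC_scaleC
         scaleC_mult_left scaleC_mult_right norm_scaleC star_star star_add star_scaleC star_mult
         norm_star_mult_self norm_triangle_ineq norm_mult_ineq\<close>)
qed

definition star_subalgebra :: "'a::cstar_algebra set \<Rightarrow> bool" where
  "star_subalgebra D \<longleftrightarrow> 0 \<in> D \<and> (\<forall>x\<in>D. \<forall>y\<in>D. x + y \<in> D) \<and> (\<forall>x\<in>D. \<forall>c. c *\<^sub>C x \<in> D) \<and>
     (\<forall>x\<in>D. \<forall>y\<in>D. x * y \<in> D) \<and> (\<forall>x\<in>D. star x \<in> D)"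

definition unital_star_hom :: "('a::cstar_algebra \<Rightarrow> 'b::cstar_algebra) \<Rightarrow> bool" where
  "unital_star_hom f \<longleftrightarrow> (\<forall>x y. f (x + y) = f x + f y) \<and> (\<forall>c x. f (c *\<^sub>C x) = c *\<^sub>C f x) \<and>
     (\<forall>x y. f (x * y) = f x * f y) \<and> (\<forall>x. f (star x) = star (f x)) \<and> f 1 = 1"

definition unital_star_hom_into :: "('a::cstar_algebra \<Rightarrow> 'c) \<Rightarrow> 'c cstar_struct \<Rightarrow> bool" where
  "unital_star_hom_into f C \<longleftrightarrow> range f \<subseteq> carrier C \<and>
     (\<forall>x y. f (x + y) = f x \<oplus>\<^bsub>C\<^esub> f y) \<and> (\<forall>c x. f (c *\<^sub>C x) = scal C c (f x)) \<and>
     (\<forall>x y. f (x * y) = f x \<otimes>\<^bsub>C\<^esub> f y) \<and> (\<forall>x. f (star x) = adj C (f x)) \<and> f 1 = \<one>\<^bsub>C\<^esub>"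


subsection \<open>The Toeplitz-Pimsner algebra\<close>

text \<open>The \<open>d\<close> symbols are the elements of the finite index type \<open>'d\<close>, so \<open>d = CARD('d) \<ge> 1\<close>.\<close>

definition cstar_dynamical_system :: "('d::finite \<Rightarrow> 'a::cstar_algebra \<Rightarrow> 'a) \<Rightarrow> bool" where
  "cstar_dynamical_system \<alpha> \<longleftrightarrow> (\<forall>i. unital_star_hom (\<alpha> i))"

definition toeplitz_relations ::
    "('d::finite \<Rightarrow> 'a::cstar_algebra \<Rightarrow> 'a) \<Rightarrow> 'c cstar_struct \<Rightarrow> ('a \<Rightarrow> 'c) \<Rightarrow> ('d \<Rightarrow> 'c) \<Rightarrow> bool" where
  "toeplitz_relations \<alpha> C \<pi> W \<longleftrightarrow> unital_star_hom_into \<pi> C \<and> range W \<subseteq> carrier C \<and>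
     (\<forall>i j. adj C (W i) \<otimes>\<^bsub>C\<^esub> W j = (if i = j then \<one>\<^bsub>C\<^esub> else \<zero>\<^bsub>C\<^esub>)) \<and>
     (\<forall>a i. \<pi> a \<otimes>\<^bsub>C\<^esub> W i = W i \<otimes>\<^bsub>C\<^esub> \<pi> (\<alpha> i a))"

text \<open>\<open>toeplitz_pimsner \<alpha> \<iota> V\<close>: the type \<open>'b\<close>, with
  the (isometric) inclusion \<open>\<iota>\<close> of \<open>A\<close> and the elements \<open>V
  i\<close>, is the universal C*-algebra of the system. In the universal property,
  \<open>C\<close> ranges over all C*-algebras carried by subsets of \<open>'b\<close>. This is no
  restriction: a C*-algebra generated by the image of \<open>A\<close> and finitely many elements
  has at most as many elements as there are sequences in \<open>A\<close>, that is,
  \<open>|A|\<close> many, and \<open>|A| \<le> |'b|\<close> because \<open>\<iota>\<close> is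
  injective; so, up to isomorphism, every C*-algebra generated by such a representation, including
  the universal one, is carried by a subset of \<open>'b\<close>. The morphism \<open>h\<close> is
  unique since \<open>A\<close> and the \<open>V i\<close> generate.\<close>

definition toeplitz_pimsner ::
    "('d::finite \<Rightarrow> 'a::cstar_algebra \<Rightarrow> 'a) \<Rightarrow> ('a \<Rightarrow> 'b::cstar_algebra) \<Rightarrow> ('d \<Rightarrow> 'b) \<Rightarrow> bool" where
  "toeplitz_pimsner \<alpha> \<iota> V \<longleftrightarrow>
     toeplitz_relations \<alpha> cstar_of_type \<iota> V \<and>
     (\<forall>a. norm (\<iota> a) = norm a) \<and>
     (\<forall>S. star_subalgebra S \<and> closed S \<and> range \<iota> \<subseteq> S \<and> range V \<subseteq> S \<longrightarrow> S = UNIV) \<and>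
     (\<forall>(C :: 'b cstar_struct) \<pi> W. cstar_structure C \<and> toeplitz_relations \<alpha> C \<pi> W \<longrightarrow>
        (\<exists>h. unital_star_hom_into h C \<and> (\<forall>a. h (\<iota> a) = \<pi> a) \<and> (\<forall>i. h (V i) = W i)))"

text \<open>The list \<open>[i\<^sub>n, \<dots>, i\<^sub>1]\<close> stands for the word \<open>i\<^sub>n\<dots>i\<^sub>1\<close>.\<close>

definition word_prod :: "('d \<Rightarrow> 'b::cstar_algebra) \<Rightarrow> 'd list \<Rightarrow> 'b" where
  "word_prod V \<mu> = prod_list (map V \<mu>)"

text \<open>For \<open>z\<close> on the unit circle, the automorphism described here exists by the universal property
  and is unique because \<open>A\<close> and the \<open>V i\<close> generate.\<close>

definition gauge :: "('a::cstar_algebra \<Rightarrow> 'b::cstar_algebra) \<Rightarrow> ('d \<Rightarrow> 'b) \<Rightarrow> complex \<Rightarrow> 'b \<Rightarrow> 'b" where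
  "gauge \<iota> V z = (THE f. unital_star_hom f \<and> bij f \<and>
     (\<forall>a. f (\<iota> a) = \<iota> a) \<and> (\<forall>i. f (V i) = z *\<^sub>C V i))"

definition gauge_flow :: "('a::cstar_algebra \<Rightarrow> 'b::cstar_algebra) \<Rightarrow> ('d \<Rightarrow> 'b) \<Rightarrow> real \<Rightarrow> 'b \<Rightarrow> 'b" where
  "gauge_flow \<iota> V t = gauge \<iota> V (exp (\<i> * complex_of_real t))"


subsection \<open>KMS states\<close>

definition state :: "('b::cstar_algebra \<Rightarrow> complex) \<Rightarrow> bool" where
  "state \<psi> \<longleftrightarrow> (\<forall>x y. \<psi> (x + y) = \<psi> x + \<psi> y) \<and> (\<forall>c x. \<psi> (c *\<^sub>C x) = c * \<psi> x) \<and>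
     (\<forall>x. \<psi> (star x * x) \<in> \<real> \<and> 0 \<le> Re (\<psi> (star x * x))) \<and> \<psi> 1 = 1"

definition tracial :: "('a::cstar_algebra \<Rightarrow> complex) \<Rightarrow> bool" where
  "tracial \<tau> \<longleftrightarrow> (\<forall>x y. \<tau> (x * y) = \<tau> (y * x))"

text \<open>Norm-differentiability in the complex sense; the library's complex derivatives are not
  available for functions with values in a C*-algebra.\<close>

definition entire :: "(complex \<Rightarrow> 'b::cstar_algebra) \<Rightarrow> bool" where
  "entire F \<longleftrightarrow> (\<forall>z. \<exists>D. ((\<lambda>w. inverse (w - z) *\<^sub>C (F w - F z)) \<longlongrightarrow> D) (at z))"

definition entire_extension :: "(real \<Rightarrow> 'b::cstar_algebra \<Rightarrow> 'b) \<Rightarrow> 'b \<Rightarrow> (complex \<Rightarrow> 'b) \<Rightarrow> bool" where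
  "entire_extension \<sigma> x F \<longleftrightarrow> entire F \<and> (\<forall>t. F (complex_of_real t) = \<sigma> t x)"

definition analytic_elements :: "(real \<Rightarrow> 'b::cstar_algebra \<Rightarrow> 'b) \<Rightarrow> 'b set" where
  "analytic_elements \<sigma> = {x. \<exists>F. entire_extension \<sigma> x F}"

text \<open>\<open>\<sigma>\<^sub>z(x)\<close> for analytic \<open>x\<close>. An entire extension is unique by the identity theorem, so the choice
  is immaterial.\<close>

definition complex_flow :: "(real \<Rightarrow> 'b::cstar_algebra \<Rightarrow> 'b) \<Rightarrow> complex \<Rightarrow> 'b \<Rightarrow> 'b" where
  "complex_flow \<sigma> z x = (SOME F. entire_extension \<sigma> x F) z"

definition kms_state :: "(real \<Rightarrow> 'b::cstar_algebra \<Rightarrow> 'b) \<Rightarrow> real \<Rightarrow> ('b \<Rightarrow> complex) \<Rightarrow> bool" where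
  "kms_state \<sigma> \<beta> \<psi> \<longleftrightarrow> state \<psi> \<and>
     (\<exists>D. star_subalgebra D \<and> closure D = UNIV \<and> D \<subseteq> analytic_elements \<sigma> \<and>
        (\<forall>t. \<forall>x\<in>D. \<sigma> t x \<in> D) \<and>
        (\<forall>x\<in>D. \<forall>y\<in>D. \<psi> (x * y) = \<psi> (y * complex_flow \<sigma> (\<i> * complex_of_real \<beta>) x)))"

end

theory Submission
  imports Defs "HOL-Complex_Analysis.Complex_Analysis"
begin

text \<open>
  A KMS state \<open>\<psi>\<close> satisfies \<open>\<psi> (x y) = exp (-n \<beta>) \<psi> (y x)\<close> for all \<open>y\<close> and all \<open>x\<close> that are
  homogeneous of degree \<open>n\<close> for the gauge action. Moving \<open>V\<^sub>\<mu>\<close> to the right of \<open>V\<^sub>\<mu> a V\<^sub>\<nu>\<^sup>*\<close> gives the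
  formula when \<open>\<mu>\<close> and \<open>\<nu>\<close> have equal length, and taking \<open>y = 1\<close> makes \<open>\<psi>\<close> vanish in nonzero degree.
  Since \<open>\<psi> (V\<^sub>i V\<^sub>i\<^sup>*) = exp (-\<beta>)\<close> and the \<open>d\<close> range projections \<open>V\<^sub>i V\<^sub>i\<^sup>*\<close> are orthogonal,
  \<open>d exp (-\<beta>) \<le> 1\<close>. Conversely, the formula makes the homogeneous KMS identity hold for generators
  \<open>x\<close> and monomials \<open>y\<close>, and it extends to all \<open>y\<close> by density and is inherited by products
  and adjoints in \<open>x\<close>.
\<close>

subsection \<open>Automatic continuity in C*-algebras\<close>

lemma scaleC_one [simp]: "(1::complex) *\<^sub>C x = (x::'a::cstar_algebra)"
  using scaleC_of_real[of 1 x] by simp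

lemma scaleC_zero_left [simp]: "(0::complex) *\<^sub>C x = (0::'a::cstar_algebra)"
  using scaleC_of_real[of 0 x] by simp

lemma scaleC_zero_right [simp]: "c *\<^sub>C (0::'a::cstar_algebra) = 0"
  by (metis norm_eq_zero norm_scaleC mult_zero_right)

lemma scaleC_minus_one [simp]: "(-1::complex) *\<^sub>C x = - (x::'a::cstar_algebra)"
  using scaleC_of_real[of "-1" x] by simp

lemma bounded_linear_scaleC_left: "bounded_linear (\<lambda>c. c *\<^sub>C (x::'a::cstar_algebra))"
proof (rule bounded_linear_intro[where K = "norm x"])
  show "(r *\<^sub>R c) *\<^sub>C x = r *\<^sub>R (c *\<^sub>C x)" for r c
    unfolding scaleC_of_real[symmetric] by (simp add: scaleR_conv_of_real scaleC_scaleC)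
qed (simp_all add: scaleC_add_left norm_scaleC)

lemma bounded_linear_scaleC_right: "bounded_linear (\<lambda>x::'a::cstar_algebra. c *\<^sub>C x)"
proof (rule bounded_linear_intro[where K = "cmod c"])
  show "c *\<^sub>C (r *\<^sub>R x) = r *\<^sub>R (c *\<^sub>C x)" for r and x :: 'a
    unfolding scaleC_of_real[symmetric] by (simp add: scaleC_scaleC mult.commute)
qed (simp_all add: scaleC_add_right norm_scaleC mult.commute)

lemma scaleC_diff_right: "c *\<^sub>C (x - y) = c *\<^sub>C x - c *\<^sub>C (y::'a::cstar_algebra)"
  by (rule linear_diff[OF bounded_linear.linear[OF bounded_linear_scaleC_right]])

lemma scaleC_diff_left: "(b - c) *\<^sub>C x = b *\<^sub>C x - c *\<^sub>C (x::'a::cstar_algebra)"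
  by (rule linear_diff[OF bounded_linear.linear[OF bounded_linear_scaleC_left]])

lemma star_scaleR: "star (r *\<^sub>R x) = r *\<^sub>R star (x::'a::cstar_algebra)"
  by (simp add: star_scaleC flip: scaleC_of_real)

text \<open>The C*-identity and submultiplicativity bound \<open>norm y\<close> by
  \<open>norm (star y)\<close>; as \<open>star\<close> is an involution, using this at
  \<open>x\<close> and at \<open>star x\<close> gives equality.\<close>

lemma norm_star [simp]: "norm (star x) = norm (x::'a::cstar_algebra)"
proof -
  have le: "norm y \<le> norm (star y)" for y :: 'a
  proof (cases "y = 0")
    case False
    have "norm y * norm y \<le> norm (star y) * norm y"
      using norm_star_mult_self[of y] norm_mult_ineq[of "star y" y] by (simp add: power2_eq_square)
    with False show ?thesis by simp
  qed simp
  show ?thesis using le[of x] le[of "star x"] by (simp add: star_star)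
qed

lemma bounded_linear_star: "bounded_linear (star :: 'a::cstar_algebra \<Rightarrow> 'a)"
  by (rule bounded_linear_intro[where K = 1]) (simp_all add: star_add star_scaleR)

lemma star_zero [simp]: "star 0 = (0::'a::cstar_algebra)"
  by (rule linear_0[OF bounded_linear.linear[OF bounded_linear_star]])

lemma star_diff: "star (x - y) = star x - star (y::'a::cstar_algebra)"
  by (rule linear_diff[OF bounded_linear.linear[OF bounded_linear_star]])

lemma star_one [simp]: "star 1 = (1::'a::cstar_algebra)"
  by (metis star_mult star_star mult_1_left mult_1_right)

lemma star_power: "star (x ^ n) = star (x::'a::cstar_algebra) ^ n"
  by (induction n) (simp_all add: star_mult power_commutes)

text \<open>Scaling by \<open>inverse r\<close>, with \<open>r\<close> slightly above
  \<open>norm x\<close>, moves \<open>x\<close> into the open unit ball. The ball is open because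
  the square roots below need norm strictly less than 1.\<close>

lemma norm_le_norm_of_unit_ball:
  fixes f :: "'a::real_normed_vector \<Rightarrow> 'b::real_normed_vector"
  assumes scale: "\<And>r x. f (r *\<^sub>R x) = r *\<^sub>R f x"
    and unit: "\<And>x. norm x < 1 \<Longrightarrow> norm (f x) \<le> 1"
  shows "norm (f x) \<le> norm x"
proof (rule field_le_epsilon)
  fix e :: real assume "e > 0"
  define r where "r = norm x + e"
  have r: "r > 0" "norm x < r" using \<open>e > 0\<close> by (auto simp: r_def intro: add_nonneg_pos)
  have "norm (f (inverse r *\<^sub>R x)) \<le> 1"
    by (rule unit) (use r in \<open>simp add: field_simps\<close>)
  then have "norm (f x) \<le> r" using r by (simp add: scale field_simps)
  then show "norm (f x) \<le> norm x + e" by (simp add: r_def)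
qed

text \<open>The square root is the sum of the binomial series.\<close>

lemma sqrt_one_minus:
  fixes a :: "'a::cstar_algebra"
  assumes "star a = a" "norm a < 1"
  obtains c where "star c = c" "c * c = 1 - a" "\<And>b. b * a = a * b \<Longrightarrow> b * c = c * b"
proof
  define u where "u n = ((1/2::real) gchoose n) *\<^sub>R ((- a) ^ n)" for n
  have summ: "summable (\<lambda>n. norm (u n))"
  proof (rule summable_comparison_test')
    have "norm (norm a) < conv_radius (\<lambda>n. (1/2::real) gchoose n)"
      using conv_radius_gchoose[of "1/2::real"] assms(2)
      by (simp add: one_ereal_def split: if_splits)
    from abs_summable_in_conv_radius[OF this]
    show "summable (\<lambda>n. norm (((1/2::real) gchoose n) * norm a ^ n))" .
    show "norm (norm (u n)) \<le> norm (((1/2::real) gchoose n) * norm a ^ n)" if "n \<ge> 0" for n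
      by (simp add: u_def abs_mult power_abs)
        (metis abs_ge_zero mult_left_mono norm_minus_cancel norm_power_ineq)
  qed
  have su: "summable u" by (rule summable_norm_cancel[OF summ])
  define c where "c = suminf u"
  have cu: "u sums c" using su by (simp add: c_def summable_sums)
  have "(\<lambda>n. star (u n)) sums star c" by (rule bounded_linear.sums[OF bounded_linear_star cu])
  moreover have "star (u n) = u n" for n
    unfolding u_def using assms(1) star_diff[of 0 a] by (simp add: star_scaleR star_power)
  ultimately show "star c = c" using cu sums_unique2 by simp
  show "b * c = c * b" if "b * a = a * b" for b
  proof -
    have p: "b * (- a) ^ n = (- a) ^ n * b" for n
      by (rule power_commuting_commutes[symmetric]) (use that in simp)
    have "b * u n = u n * b" for n
      unfolding u_def using p by simp
    then show ?thesis
      using bounded_linear.sums[OF bounded_linear_mult_right cu, of b]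
        bounded_linear.sums[OF bounded_linear_mult_left cu, of b] sums_unique2 by simp
  qed
  have "(\<lambda>n. \<Sum>i\<le>n. u i * u (n - i)) sums (c * c)"
    unfolding c_def by (rule Cauchy_product_sums[OF summ summ])
  \<comment> \<open>The coefficient is the Vandermonde convolution of 1/2 with itself, that is
    \<open>1 choose n\<close>, so only the terms of degree 0 and 1 survive.\<close>
  moreover have "(\<Sum>i\<le>n. u i * u (n - i)) = (if n = 0 then 1 else if n = 1 then - a else 0)" for n
  proof -
    have "(\<Sum>i\<le>n. u i * u (n - i)) =
        (\<Sum>i\<le>n. ((1/2::real) gchoose i) * ((1/2) gchoose (n - i))) *\<^sub>R ((- a) ^ n)"
      unfolding scaleR_sum_left u_def
      by (intro sum.cong) (simp_all flip: power_add)
    also have "(\<Sum>i\<le>n. ((1/2::real) gchoose i) * ((1/2) gchoose (n - i))) = (of_nat 1 gchoose n)"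
      using gbinomial_Vandermonde[of "1/2::real" "1/2" n] by (simp add: atMost_atLeast0)
    also have "\<dots> = real (1 choose n)" by (simp only: binomial_gbinomial)
    finally show ?thesis by (auto simp: binomial_eq_0)
  qed
  moreover have "(\<lambda>n. if n = 0 then 1 else if n = 1 then - a else 0) sums (1 - a)"
  proof -
    have "(\<lambda>n. if n = 0 then 1 else if n = 1 then - a else 0) sums
        (\<Sum>n\<in>{0,1}. if n = (0::nat) then 1 else if n = 1 then - a else 0)"
      by (rule sums_finite) auto
    then show ?thesis by simp
  qed
  ultimately show "c * c = 1 - a" using sums_unique2 by simp
qed

lemma unital_star_homD:
  assumes "unital_star_hom f"
  shows "f (x + y) = f x + f y" "f (c *\<^sub>C x) = c *\<^sub>C f x" "f (x * y) = f x * f y"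
    "f (star x) = star (f x)" "f 1 = 1"
  using assms by (auto simp: unital_star_hom_def)

lemma unital_star_hom_scaleR: "unital_star_hom f \<Longrightarrow> f (r *\<^sub>R x) = r *\<^sub>R f x"
  using unital_star_homD(2)[of f "of_real r" x] by (simp add: scaleC_of_real)

lemma unital_star_hom_diff: "unital_star_hom f \<Longrightarrow> f (x - y) = f x - f y"
  by (rule Modules.additive.diff) (simp add: Modules.additive_def unital_star_homD)

lemma unital_star_hom_comp: "unital_star_hom f \<Longrightarrow> unital_star_hom g \<Longrightarrow> unital_star_hom (f \<circ> g)"
  by (simp add: unital_star_hom_def)

text \<open>A self-adjoint \<open>a\<close> with \<open>norm a < 1\<close> is the real part of the unitary
  \<open>a + \<i> sqrt (1 - a\<^sup>2)\<close>, and unitaries are mapped to unitaries.\<close>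

lemma norm_unital_star_hom_le:
  fixes f :: "'a::cstar_algebra \<Rightarrow> 'b::cstar_algebra"
  assumes f: "unital_star_hom f"
  shows "norm (f x) \<le> norm x"
proof -
  have sa: "norm (f a) \<le> 1" if a: "star a = a" "norm a < 1" for a
  proof -
    have n: "norm (a * a) < 1"
      using norm_star_mult_self[of a] a by (simp add: power_less_one_iff)
    \<comment> \<open>\<open>c\<close> commutes with \<open>a\<close> because \<open>a\<close>
      commutes with \<open>a * a\<close>; this makes the cross terms in \<open>star u * u\<close>
      cancel.\<close>
    obtain c where c: "star c = c" "c * c = 1 - a * a" "a * c = c * a"
      using sqrt_one_minus[of "a * a"] n a(1) by (metis mult.assoc star_mult)
    define u where "u = f a + \<i> *\<^sub>C f c"
    have su: "star u = f a - \<i> *\<^sub>C f c"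
      using f a c scaleC_diff_left[of 0 \<i> "f c"]
      by (simp add: u_def star_add star_scaleC flip: unital_star_homD(4))
    have "star u * u = f (a * a) + f (c * c)"
      unfolding su using c(3) f
      by (simp add: u_def algebra_simps scaleC_mult_left scaleC_mult_right scaleC_scaleC
          scaleC_diff_right scaleC_add_right flip: unital_star_homD(3))
    also have "\<dots> = 1" using c(2) f by (simp add: unital_star_hom_diff unital_star_homD(5))
    finally have "norm u = 1"
      using norm_star_mult_self[of u] norm_ge_zero[of u]
      by (auto simp: power2_eq_1_iff)
    then have "norm (u + star u) \<le> 2" using norm_triangle_ineq[of u "star u"] by simp
    moreover have "u + star u = 2 *\<^sub>R f a" unfolding su by (simp add: u_def scaleR_2)
    ultimately show ?thesis by simp
  qed
  \<comment> \<open>The C*-identity reduces a general \<open>x\<close> to the self-adjoint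
    \<open>star x * x\<close>.\<close>
  have sa': "norm (f x) \<le> 1" if "norm x < 1" for x
  proof -
    have "norm (f (star x * x)) \<le> 1"
    proof (rule sa)
      show "norm (star x * x) < 1" using that by (simp add: norm_star_mult_self power_less_one_iff)
    qed (simp add: star_mult star_star)
    then have "(norm (f x))\<^sup>2 \<le> 1"
      using f by (simp add: unital_star_homD norm_star_mult_self)
    then show ?thesis by (simp add: power_le_one_iff abs_square_le_1)
  qed
  show ?thesis
    by (rule norm_le_norm_of_unit_ball[OF unital_star_hom_scaleR[OF f] sa'])
qed

lemma bounded_linear_unital_star_hom: "unital_star_hom f \<Longrightarrow> bounded_linear f"
  by (rule bounded_linear_intro[where K = 1])
    (simp_all add: unital_star_homD unital_star_hom_scaleR norm_unital_star_hom_le)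

section \<open>States are hermitian and contractive\<close>

lemma stateD:
  assumes "state \<psi>"
  shows "\<psi> (x + y) = \<psi> x + \<psi> y" "\<psi> (c *\<^sub>C x) = c * \<psi> x" "\<psi> (star x * x) \<in> \<real>"
    "0 \<le> Re (\<psi> (star x * x))" "\<psi> 1 = 1"
  using assms by (auto simp: state_def)

lemma state_diff: "state \<psi> \<Longrightarrow> \<psi> (x - y) = \<psi> x - \<psi> y"
  by (rule Modules.additive.diff) (simp add: Modules.additive_def stateD)

lemma state_zero: "state \<psi> \<Longrightarrow> \<psi> 0 = 0"
  using state_diff[of \<psi> 0 0] by simp

text \<open>Since \<open>\<psi>\<close> is real on \<open>star y * y\<close> for
  \<open>y = 1 + c *\<^sub>C x\<close>, a linear condition links \<open>\<psi> x\<close> and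
  \<open>\<psi> (star x)\<close>: \<open>c = 1\<close> compares imaginary parts,
  \<open>c = \<i>\<close> real parts.\<close>

lemma state_star:
  assumes "state \<psi>"
  shows "\<psi> (star x) = cnj (\<psi> x)"
proof -
  have im: "Im (c * \<psi> x + cnj c * \<psi> (star x)) = 0" for c
  proof -
    have "star (1 + c *\<^sub>C x) * (1 + c *\<^sub>C x)
        = 1 + c *\<^sub>C x + cnj c *\<^sub>C star x + (cnj c * c) *\<^sub>C (star x * x)"
      by (simp add: star_add star_scaleC algebra_simps scaleC_mult_left scaleC_mult_right scaleC_scaleC
          scaleC_add_right)
    then have "\<psi> (star (1 + c *\<^sub>C x) * (1 + c *\<^sub>C x)) =
        1 + c * \<psi> x + cnj c * \<psi> (star x) + (cnj c * c) * \<psi> (star x * x)"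
      by (simp add: stateD[OF assms])
    moreover have "Im (\<psi> (star x * x)) = 0"
      using stateD(3)[OF assms, of x] by (simp add: complex_is_Real_iff)
    ultimately show ?thesis
      using stateD(3)[OF assms, of "1 + c *\<^sub>C x"] by (simp add: complex_is_Real_iff)
  qed
  show ?thesis using im[of 1] im[of \<i>] by (simp add: complex_eq_iff)
qed

text \<open>Positivity is used twice: \<open>1 - star x * x\<close> is a square, so
  \<open>\<psi> (star x * x)\<close> has real part at most 1, and the variance of \<open>x\<close>
  is nonnegative, so this real part dominates \<open>(cmod (\<psi> x))\<^sup>2\<close>.\<close>

lemma norm_state_le:
  assumes "state \<psi>"
  shows "cmod (\<psi> x) \<le> norm x"
proof (rule norm_le_norm_of_unit_ball)
  show "\<psi> (r *\<^sub>R x) = r *\<^sub>R \<psi> x" for r x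
    using stateD(2)[OF assms, of "of_real r" x] by (simp add: scaleC_of_real scaleR_conv_of_real)
next
  fix x :: 'a assume x: "norm x < 1"
  have "norm (star x * x) < 1" using x by (simp add: norm_star_mult_self power_less_one_iff)
  then obtain c where c: "star c = c" "c * c = 1 - star x * x"
    using sqrt_one_minus[of "star x * x"] by (metis star_mult star_star)
  have le: "Re (\<psi> (star x * x)) \<le> 1"
    using stateD(4)[OF assms, of c] c by (simp add: state_diff[OF assms] stateD(5)[OF assms])
  \<comment> \<open>\<open>x\<close> minus its mean, so that \<open>\<psi> (star y * y)\<close> is
    the variance of \<open>x\<close>.\<close>
  define y where "y = x - \<psi> x *\<^sub>C 1"
  have "star y * y = star x * x - \<psi> x *\<^sub>C star x - cnj (\<psi> x) *\<^sub>C x + (cnj (\<psi> x) * \<psi> x) *\<^sub>C 1"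
    by (simp add: y_def star_diff star_scaleC algebra_simps scaleC_mult_left scaleC_mult_right
        scaleC_scaleC scaleC_diff_right)
  then have "\<psi> (star y * y) = \<psi> (star x * x) - cnj (\<psi> x) * \<psi> x"
    by (simp add: stateD[OF assms] state_diff[OF assms] state_star[OF assms])
  then have "(cmod (\<psi> x))\<^sup>2 \<le> Re (\<psi> (star x * x))"
    using stateD(4)[OF assms, of y] unfolding cmod_power2 by (simp add: power2_eq_square)
  with le have "(cmod (\<psi> x))\<^sup>2 \<le> 1" by simp
  then show "cmod (\<psi> x) \<le> 1" by (simp add: abs_square_le_1)
qed

subsection \<open>Entire functions and Fourier coefficients\<close>

text \<open>Gives access to scalar complex analysis: the functional maps difference quotients to
  difference quotients. As \<open>bounded_linear\<close> is real linearity, complex homogeneity is a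
  separate assumption.\<close>

lemma holomorphic_functional_entire:
  fixes \<phi> :: "'b::cstar_algebra \<Rightarrow> complex"
  assumes "bounded_linear \<phi>" and hom: "\<And>c x. \<phi> (c *\<^sub>C x) = c * \<phi> x" and F: "entire F"
  shows "(\<lambda>z. \<phi> (F z)) holomorphic_on UNIV"
proof -
  interpret bounded_linear \<phi> by fact
  have "\<exists>D. ((\<lambda>z. \<phi> (F z)) has_field_derivative D) (at z)" for z
  proof -
    obtain D where "((\<lambda>w. inverse (w - z) *\<^sub>C (F w - F z)) \<longlongrightarrow> D) (at z)"
      using F by (auto simp: entire_def)
    then have "((\<lambda>w. \<phi> (inverse (w - z) *\<^sub>C (F w - F z))) \<longlongrightarrow> \<phi> D) (at z)" by (rule tendsto)
    then show ?thesis
      by (auto simp: has_field_derivative_iff hom diff divide_inverse mult.commute)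
  qed
  then show ?thesis by (simp add: holomorphic_on_def field_differentiable_def)
qed

lemma entire_add:
  assumes "entire F" "entire G"
  shows "entire (\<lambda>z. F z + G z)"
  unfolding entire_def
proof
  fix z
  obtain D where D: "((\<lambda>w. inverse (w - z) *\<^sub>C (F w - F z)) \<longlongrightarrow> D) (at z)"
    using assms(1) unfolding entire_def by blast
  obtain E where E: "((\<lambda>w. inverse (w - z) *\<^sub>C (G w - G z)) \<longlongrightarrow> E) (at z)"
    using assms(2) unfolding entire_def by blast
  from tendsto_add[OF D E]
  show "\<exists>D. ((\<lambda>w. inverse (w - z) *\<^sub>C (F w + G w - (F z + G z))) \<longlongrightarrow> D) (at z)"
    unfolding add_diff_add scaleC_add_right by blast
qed

text \<open>Used with exponentials \<open>f\<close>, which describe the orbits of homogeneous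
  elements.\<close>

lemma entire_scaleC:
  assumes "f holomorphic_on UNIV"
  shows "entire (\<lambda>z. f z *\<^sub>C x)"
  unfolding entire_def
proof
  fix z
  obtain D where "(f has_field_derivative D) (at z)"
    using assms by (auto simp: holomorphic_on_def field_differentiable_def)
  then have "((\<lambda>w. (f w - f z) / (w - z)) \<longlongrightarrow> D) (at z)" by (simp add: has_field_derivative_iff)
  from bounded_linear.tendsto[OF bounded_linear_scaleC_left this, of x]
  have "((\<lambda>w. ((f w - f z) / (w - z)) *\<^sub>C x) \<longlongrightarrow> D *\<^sub>C x) (at z)" .
  moreover have "((f w - f z) / (w - z)) *\<^sub>C x = inverse (w - z) *\<^sub>C (f w *\<^sub>C x - f z *\<^sub>C x)" for w
    unfolding scaleC_diff_left[symmetric] scaleC_scaleC by (simp add: divide_inverse mult.commute)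
  ultimately show "\<exists>D. ((\<lambda>w. inverse (w - z) *\<^sub>C (f w *\<^sub>C x - f z *\<^sub>C x)) \<longlongrightarrow> D) (at z)"
    by auto
qed

text \<open>Identity theorem: the real line accumulates at 0, so the difference vanishes
  everywhere.\<close>

lemma holomorphic_eq_of_real:
  assumes "f holomorphic_on UNIV" "g holomorphic_on UNIV"
    and eq: "\<And>t::real. f (of_real t) = g (of_real t)"
  shows "f z = g z"
proof -
  have lim: "(0::complex) islimpt range of_real"
    unfolding islimpt_approachable
  proof (intro allI impI)
    fix e :: real assume "e > 0"
    then show "\<exists>x'\<in>range complex_of_real. x' \<noteq> 0 \<and> dist x' 0 < e"
      by (intro bexI[OF _ rangeI[of complex_of_real "e / 2"]]) (simp_all add: norm_mult)
  qed
  have "(\<lambda>z. f z - g z) z = 0"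
  proof (rule analytic_continuation[where f = "\<lambda>z. f z - g z" and w = z and S = UNIV and U = "range of_real" and \<xi> = 0])
    show "(\<lambda>z. f z - g z) holomorphic_on UNIV" using assms by (intro holomorphic_intros)
  qed (use eq lim in auto)
  then show ?thesis by simp
qed

text \<open>A primitive \<open>P\<close> of \<open>exp (-\<i> n z) g z\<close> has constant increment over a period, by
  \<open>2\<pi>\<close>-periodicity, so the integral over a period does not depend on the height.\<close>

lemma fourier_coefficient_shift:
  fixes g :: "complex \<Rightarrow> complex" and \<beta> :: real and n :: int
  assumes g: "g holomorphic_on UNIV"
    and per: "\<And>t::real. g (of_real (t + 2 * pi)) = g (of_real t)"
  shows "integral {0..2*pi} (\<lambda>t. exp (- (\<i> * of_int n * of_real t)) * g (of_real t + \<i> * of_real \<beta>)) =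
    exp (- of_int n * of_real \<beta>) * integral {0..2*pi} (\<lambda>t. exp (- (\<i> * of_int n * of_real t)) * g (of_real t))"
proof -
  define H where "H z = exp (- (\<i> * of_int n * z)) * g z" for z
  have H: "H holomorphic_on UNIV" unfolding H_def using g by (intro holomorphic_intros)
  have shift: "(\<lambda>z. f (z + 2 * of_real pi)) holomorphic_on UNIV"
    if "f holomorphic_on UNIV" for f :: "complex \<Rightarrow> complex"
  proof -
    have "(\<lambda>z. z + 2 * of_real pi) holomorphic_on UNIV" by (intro holomorphic_intros)
    from holomorphic_on_compose[OF this, of f] holomorphic_on_subset[OF that]
    show ?thesis by (simp add: o_def)
  qed
  \<comment> \<open>Periodicity is given on the real line and propagates to the plane by the
    identity theorem.\<close>
  have "g (of_real t + 2 * of_real pi) = g (of_real t)" for t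
    using per[of t] by simp
  from holomorphic_eq_of_real[OF shift[OF g] g this]
  have gper: "g (z + 2 * of_real pi) = g z" for z .
  have "exp (- (\<i> * of_int n * (2 * of_real pi))) = 1"
    using exp_integer_2pi[of "of_int (- n)"] by (simp add: mult_ac)
  moreover have "exp (- (\<i> * of_int n * (z + 2 * of_real pi))) =
      exp (- (\<i> * of_int n * z)) * exp (- (\<i> * of_int n * (2 * of_real pi)))" for z
    by (simp add: ring_distribs flip: exp_add)
  ultimately have Hper: "H (z + 2 * of_real pi) = H z" for z
    by (simp only: H_def gper mult_1_right)
  obtain P where P: "\<And>z. (P has_field_derivative H z) (at z)"
    using holomorphic_convex_primitive'[OF _ _ H] by auto
  have int: "((\<lambda>t. H (of_real t + w)) has_integral (P (of_real (2 * pi) + w) - P (of_real 0 + w))) {0..2*pi}" for w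
  proof (rule fundamental_theorem_of_calculus)
    fix t :: real
    have "((\<lambda>t. of_real t + w) has_vector_derivative 1) (at t)"
      by (auto intro!: derivative_eq_intros has_vector_derivative_of_real)
    from field_vector_diff_chain_at[OF this P]
    show "((\<lambda>t. P (of_real t + w)) has_vector_derivative H (of_real t + w)) (at t within {0..2*pi})"
      by (auto simp: o_def intro: has_vector_derivative_at_within)
  qed simp
  have const: "P (z + 2 * of_real pi) - P z = P (2 * of_real pi) - P 0" for z
  proof -
    have "((\<lambda>z. P (z + 2 * of_real pi) - P z) has_field_derivative 0) (at z)" for z
      using DERIV_diff[OF DERIV_shift[THEN iffD1, OF P[of "z + 2 * of_real pi"]] P[of z]]
      by (simp add: Hper)
    then obtain c where "\<And>z. P (z + 2 * of_real pi) - P z = c"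
      using has_field_derivative_zero_constant[of UNIV "\<lambda>z. P (z + 2 * of_real pi) - P z"] by auto
    from this[of z] this[of 0] show ?thesis by simp
  qed
  have "integral {0..2*pi} (\<lambda>t. H (of_real t + \<i> * of_real \<beta>)) = integral {0..2*pi} (\<lambda>t. H (of_real t))"
    using integral_unique[OF int[of "\<i> * of_real \<beta>"]] integral_unique[OF int[of 0]]
      const[of "\<i> * of_real \<beta>"] by (simp add: add.commute)
  \<comment> \<open>At height \<open>\<beta>\<close> the exponential in \<open>H\<close> picks up
    the factor \<open>exp (n \<beta>)\<close>, whose inverse appears in the claim.\<close>
  moreover have "H (of_real t + \<i> * of_real \<beta>) = exp (of_int n * of_real \<beta>) *
      (exp (- (\<i> * of_int n * of_real t)) * g (of_real t + \<i> * of_real \<beta>))" for t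
    by (simp add: H_def algebra_simps flip: exp_add)
  ultimately have "exp (of_int n * of_real \<beta>) *
      integral {0..2*pi} (\<lambda>t. exp (- (\<i> * of_int n * of_real t)) * g (of_real t + \<i> * of_real \<beta>)) =
      integral {0..2*pi} (\<lambda>t. H (of_real t))" (is "_ * ?I = ?J")
    by (simp only: integral_mult_right)
  moreover have "?I = exp (- of_int n * of_real \<beta>) * (exp (of_int n * of_real \<beta>) * ?I)"
    by (simp flip: mult.assoc exp_add)
  ultimately have "?I = exp (- of_int n * of_real \<beta>) * ?J" by simp
  then show ?thesis by (simp only: H_def)
qed

subsection \<open>Complex spans and dense subalgebras\<close>

text \<open>The complex linear span, in a form whose induction peels off one scaled generator at a
  time.\<close>

inductive_set cspan :: "'a::cstar_algebra set \<Rightarrow> 'a set" for S where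
  cspan_zero: "0 \<in> cspan S"
| cspan_step: "x \<in> S \<Longrightarrow> y \<in> cspan S \<Longrightarrow> c *\<^sub>C x + y \<in> cspan S"

lemma cspan_base: "x \<in> S \<Longrightarrow> x \<in> cspan S"
  using cspan_step[OF _ cspan_zero, of x S 1] by simp

lemma cspan_add: "x \<in> cspan S \<Longrightarrow> y \<in> cspan S \<Longrightarrow> x + y \<in> cspan S"
  by (induction rule: cspan.induct) (auto simp: add.assoc intro: cspan_step)

lemma cspan_scaleC: "x \<in> cspan S \<Longrightarrow> c *\<^sub>C x \<in> cspan S"
  by (induction rule: cspan.induct) (auto simp: scaleC_add_right scaleC_scaleC intro: cspan.intros)

lemma cspan_mult_left:
  assumes "y \<in> cspan S" "\<And>z. z \<in> S \<Longrightarrow> x * z \<in> cspan T"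
  shows "x * y \<in> cspan T"
  using assms(1)
  by (induction rule: cspan.induct)
    (auto simp: distrib_left scaleC_mult_right intro: cspan_zero cspan_add cspan_scaleC assms(2))

lemma cspan_mult:
  assumes "x \<in> cspan S" "y \<in> cspan S" "\<And>x y. x \<in> S \<Longrightarrow> y \<in> S \<Longrightarrow> x * y \<in> S"
  shows "x * y \<in> cspan S"
  using assms(1)
proof (induction rule: cspan.induct)
  case (cspan_step x y' c)
  have "x * y \<in> cspan S"
    by (rule cspan_mult_left[OF assms(2)]) (use cspan_step assms(3) in \<open>auto intro: cspan_base\<close>)
  then show ?case
    using cspan_step by (simp add: distrib_right scaleC_mult_left cspan_add cspan_scaleC)
qed (simp add: cspan_zero)

lemma star_subalgebra_cspan:
  assumes "\<And>x y. x \<in> S \<Longrightarrow> y \<in> S \<Longrightarrow> x * y \<in> S" "\<And>x. x \<in> S \<Longrightarrow> star x \<in> S"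
  shows "star_subalgebra (cspan S)"
proof -
  have "star x \<in> cspan S" if "x \<in> cspan S" for x
    using that by (induction rule: cspan.induct)
      (auto simp: star_add star_scaleC intro: cspan_zero cspan_step assms(2))
  then show ?thesis
    using assms(1) by (auto simp: star_subalgebra_def intro: cspan_zero cspan_add cspan_scaleC cspan_mult)
qed

text \<open>Scaling and \<open>star\<close> are bounded and real linear, hence pass to the closure;
  sums and products pass by joint continuity, as \<open>closure D \<times> closure D\<close> is the
  closure of \<open>D \<times> D\<close>.\<close>

lemma star_subalgebra_closure:
  assumes "star_subalgebra (D :: 'a::cstar_algebra set)"
  shows "star_subalgebra (closure D)"
proof -
  have scale: "c *\<^sub>C x \<in> closure D" if "x \<in> closure D" for c x
    using that closure_bounded_linear_image_subset[OF bounded_linear_scaleC_right, of c D]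
      closure_mono[of "(\<lambda>x. c *\<^sub>C x) ` D" D] assms unfolding star_subalgebra_def by blast
  have star: "star x \<in> closure D" if "x \<in> closure D" for x
    using that closure_bounded_linear_image_subset[OF bounded_linear_star, of D]
      closure_mono[of "star ` D" D] assms unfolding star_subalgebra_def by blast
  have bin: "f x y \<in> closure D"
    if "x \<in> closure D" "y \<in> closure D" "continuous_on UNIV (\<lambda>p. f (fst p) (snd p))"
      "\<And>x y. x \<in> D \<Longrightarrow> y \<in> D \<Longrightarrow> f x y \<in> D" for f x y
  proof -
    have "(\<lambda>p. f (fst p) (snd p)) ` closure (D \<times> D) \<subseteq> closure ((\<lambda>p. f (fst p) (snd p)) ` (D \<times> D))"
      by (rule image_closure_subset[OF continuous_on_subset[OF that(3)]]) (auto intro: closure_subset[THEN subsetD])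
    also have "\<dots> \<subseteq> closure D" by (rule closure_mono) (use that(4) in auto)
    finally show ?thesis using that(1,2) by (force simp: closure_Times)
  qed
  have add: "x + y \<in> closure D" if "x \<in> closure D" "y \<in> closure D" for x y
    by (rule bin[OF that]) (use assms in \<open>auto simp: star_subalgebra_def
        intro!: continuous_on_add continuous_on_fst continuous_on_snd continuous_on_id\<close>)
  have mult: "x * y \<in> closure D" if "x \<in> closure D" "y \<in> closure D" for x y
    by (rule bin[OF that]) (use assms in \<open>auto simp: star_subalgebra_def
        intro!: continuous_on_mult continuous_on_fst continuous_on_snd continuous_on_id\<close>)
  have "0 \<in> closure D"
    using assms closure_subset[of D] by (auto simp: star_subalgebra_def)
  then show ?thesis by (simp add: star_subalgebra_def add mult scale star)
qed

section \<open>Continuous functionals and entire extensions\<close>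

lemma bounded_linear_state:
  assumes "state \<psi>"
  shows "bounded_linear \<psi>"
proof (rule bounded_linear_intro[where K = 1])
  show "\<psi> (r *\<^sub>R x) = r *\<^sub>R \<psi> x" for r x
    using stateD(2)[OF assms, of "of_real r" x] by (simp add: scaleC_of_real scaleR_conv_of_real)
qed (simp_all add: stateD[OF assms] norm_state_le[OF assms])

lemma bounded_linear_state_mult:
  assumes "state \<psi>"
  shows "bounded_linear (\<lambda>x. \<psi> (x * y))" "bounded_linear (\<lambda>x. \<psi> (y * x))"
  by (rule bounded_linear_compose[OF bounded_linear_state[OF assms]],
      rule bounded_linear_mult_left bounded_linear_mult_right)+

lemma norm_state_mult_le:
  assumes "state \<psi>"
  shows "cmod (\<psi> (x * y)) \<le> norm y * norm x" "cmod (\<psi> (y * x)) \<le> norm y * norm x"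
  using norm_state_le[OF assms] norm_mult_ineq order_trans by (metis mult.commute)+

lemma state_mult_scaleC:
  assumes "state \<psi>"
  shows "\<psi> (c *\<^sub>C x * y) = c * \<psi> (x * y)" "\<psi> (y * c *\<^sub>C x) = c * \<psi> (y * x)"
  by (simp_all add: scaleC_mult_left scaleC_mult_right stateD[OF assms])

text \<open>Only the values of functionals on entire extensions enter, so the uniqueness of the extension
  reduces to the scalar identity theorem.\<close>

lemma entire_extension_functional_eq:
  fixes \<phi> :: "'b::cstar_algebra \<Rightarrow> complex"
  assumes "bounded_linear \<phi>" "\<And>c x. \<phi> (c *\<^sub>C x) = c * \<phi> x"
    and "entire_extension \<sigma> x F" "entire_extension \<sigma> x G"
  shows "\<phi> (F z) = \<phi> (G z)"
proof (rule holomorphic_eq_of_real[where f = "\<lambda>z. \<phi> (F z)" and g = "\<lambda>z. \<phi> (G z)"])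
  show "(\<lambda>z. \<phi> (F z)) holomorphic_on UNIV" "(\<lambda>z. \<phi> (G z)) holomorphic_on UNIV"
    by (rule holomorphic_functional_entire[OF assms(1,2)]; use assms(3,4) in \<open>simp add: entire_extension_def\<close>)+
qed (use assms(3,4) in \<open>simp add: entire_extension_def\<close>)

lemma entire_extension_complex_flow:
  assumes "x \<in> analytic_elements \<sigma>"
  shows "entire_extension \<sigma> x (\<lambda>z. complex_flow \<sigma> z x)"
  unfolding complex_flow_def using assms someI_ex[of "entire_extension \<sigma> x"]
  by (simp add: analytic_elements_def)

text \<open>Continuity along the orbit comes from the entire extension; it makes the Fourier
  integrands integrable.\<close>

lemma continuous_on_functional_flow:
  fixes \<phi> :: "'b::cstar_algebra \<Rightarrow> complex"
  assumes \<phi>: "bounded_linear \<phi>" "\<And>c x. \<phi> (c *\<^sub>C x) = c * \<phi> x" and x: "entire_extension \<sigma> x F"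
  shows "continuous_on UNIV (\<lambda>t. \<phi> (\<sigma> t x))"
proof -
  have "continuous_on UNIV (\<lambda>z. \<phi> (F z))"
    using holomorphic_functional_entire[OF \<phi>] x
    by (auto simp: entire_extension_def intro: holomorphic_on_imp_continuous_on)
  then have "continuous_on UNIV (\<lambda>t. \<phi> (F (of_real t)))"
    by (rule continuous_on_compose2) (auto intro: continuous_intros)
  with x show ?thesis by (simp add: entire_extension_def)
qed

lemma word_prod_simps [simp]:
  "word_prod V [] = 1" "word_prod V (i # \<mu>) = V i * word_prod V \<mu>"
  "word_prod V (\<mu> @ \<nu>) = word_prod V \<mu> * word_prod V \<nu>"
  by (simp_all add: word_prod_def)

subsection \<open>The gauge action and homogeneous elements\<close>

locale toeplitz_algebra =
  fixes \<alpha> :: "'d::finite \<Rightarrow> 'a::cstar_algebra \<Rightarrow> 'a"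
    and \<iota> :: "'a \<Rightarrow> 'b::cstar_algebra"
    and V :: "'d \<Rightarrow> 'b"
  assumes system: "cstar_dynamical_system \<alpha>"
    and universal: "toeplitz_pimsner \<alpha> \<iota> V"
begin

lemma unital_star_hom_\<iota>: "unital_star_hom \<iota>"
  using universal
  by (simp add: toeplitz_pimsner_def toeplitz_relations_def unital_star_hom_into_def
      unital_star_hom_def cstar_of_type_def)

lemmas \<iota>_simps = unital_star_homD[OF unital_star_hom_\<iota>]

lemma star_V_mult_V: "star (V i) * V j = (if i = j then 1 else 0)"
  using universal by (simp add: toeplitz_pimsner_def toeplitz_relations_def cstar_of_type_def)

lemma \<iota>_mult_V: "\<iota> a * V i = V i * \<iota> (\<alpha> i a)"
  using universal by (simp add: toeplitz_pimsner_def toeplitz_relations_def cstar_of_type_def)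

lemma star_V_mult_\<iota>: "star (V i) * \<iota> a = \<iota> (\<alpha> i a) * star (V i)"
proof -
  have "star (\<iota> (star a) * V i) = star (V i * \<iota> (\<alpha> i (star a)))" by (simp add: \<iota>_mult_V)
  moreover have "\<alpha> i (star a) = star (\<alpha> i a)"
    using system by (simp add: cstar_dynamical_system_def unital_star_homD(4))
  ultimately show ?thesis by (simp add: star_mult \<iota>_simps(4) star_star)
qed

lemma generating:
  assumes "star_subalgebra S" "closed S" "range \<iota> \<subseteq> S" "range V \<subseteq> S"
  shows "S = UNIV"
  using assms universal by (simp add: toeplitz_pimsner_def)

text \<open>The equaliser is a star-subalgebra containing the generators, and it is closed because
  unital star-homomorphisms are contractive.\<close>

lemma unital_star_hom_eqI:
  assumes f: "unital_star_hom f" and g: "unital_star_hom g"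
    and "\<And>a. f (\<iota> a) = g (\<iota> a)" "\<And>i. f (V i) = g (V i)"
  shows "f = g"
proof -
  have "{x. f x = g x} = UNIV"
  proof (rule generating)
    show "star_subalgebra {x. f x = g x}"
      using f g unital_star_homD(2)[OF f, of 0 0] unital_star_homD(2)[OF g, of 0 0]
      by (auto simp: star_subalgebra_def unital_star_homD)
    show "closed {x. f x = g x}"
      by (intro closed_Collect_eq linear_continuous_on bounded_linear_unital_star_hom f g)
  qed (use assms in auto)
  then show ?thesis by auto
qed

text \<open>The elements \<open>z *\<^sub>C V i\<close> satisfy the same relations because
  \<open>cnj z * z = 1\<close>; the universal property is applied with \<open>'b\<close> itself as
  target.\<close>

lemma scaled_hom_exists:
  assumes "cmod z = 1"
  obtains h where "unital_star_hom h" "\<And>a. h (\<iota> a) = \<iota> a" "\<And>i. h (V i) = z *\<^sub>C V i"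
proof -
  have z: "cnj z * z = 1" using complex_norm_square[of z] assms by (simp add: mult.commute)
  have "toeplitz_relations \<alpha> cstar_of_type \<iota> (\<lambda>i. z *\<^sub>C V i)"
    using unital_star_hom_\<iota> z
    by (simp add: toeplitz_relations_def unital_star_hom_into_def unital_star_hom_def cstar_of_type_def
        star_scaleC scaleC_mult_left scaleC_mult_right scaleC_scaleC star_V_mult_V \<iota>_mult_V mult.commute)
  then obtain h where "unital_star_hom_into h (cstar_of_type :: 'b cstar_struct)"
      "\<And>a. h (\<iota> a) = \<iota> a" "\<And>i. h (V i) = z *\<^sub>C V i"
    using universal cstar_structure_cstar_of_type unfolding toeplitz_pimsner_def by metis
  then show ?thesis
    by (intro that[of h]) (auto simp: unital_star_hom_into_def unital_star_hom_def cstar_of_type_def)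
qed

text \<open>Justifies the definite description in \<open>gauge\<close>: the homomorphisms for
  \<open>z\<close> and \<open>cnj z\<close> are mutually inverse on generators, hence everywhere,
  and uniqueness follows from generation.\<close>

lemma gauge_hom:
  assumes "cmod z = 1"
  shows "unital_star_hom (gauge \<iota> V z)" "gauge \<iota> V z (\<iota> a) = \<iota> a" "gauge \<iota> V z (V i) = z *\<^sub>C V i"
proof -
  obtain h where h: "unital_star_hom h" "\<And>a. h (\<iota> a) = \<iota> a" "\<And>i. h (V i) = z *\<^sub>C V i"
    using scaled_hom_exists[OF assms] by blast
  obtain k where k: "unital_star_hom k" "\<And>a. k (\<iota> a) = \<iota> a" "\<And>i. k (V i) = cnj z *\<^sub>C V i"
    using scaled_hom_exists[of "cnj z"] assms by (metis complex_mod_cnj)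
  have z: "cnj z * z = 1" using complex_norm_square[of z] assms by (simp add: mult.commute)
  have id: "unital_star_hom id" by (simp add: unital_star_hom_def)
  have "h \<circ> k = id" "k \<circ> h = id"
    using z by (intro unital_star_hom_eqI unital_star_hom_comp h(1) k(1) id;
      simp add: h k unital_star_homD(2)[OF h(1)] unital_star_homD(2)[OF k(1)] scaleC_scaleC mult.commute)+
  then have "bij h" by (metis o_bij)
  with h have "\<exists>!f. unital_star_hom f \<and> bij f \<and> (\<forall>a. f (\<iota> a) = \<iota> a) \<and> (\<forall>i. f (V i) = z *\<^sub>C V i)"
    by (intro ex1I[of _ h]) (auto intro: unital_star_hom_eqI)
  from theI'[OF this]
  show "unital_star_hom (gauge \<iota> V z)" "gauge \<iota> V z (\<iota> a) = \<iota> a" "gauge \<iota> V z (V i) = z *\<^sub>C V i"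
    by (simp_all add: gauge_def)
qed

abbreviation \<sigma> :: "real \<Rightarrow> 'b \<Rightarrow> 'b" where "\<sigma> \<equiv> gauge_flow \<iota> V"

lemma flow:
  shows unital_star_hom_flow: "unital_star_hom (\<sigma> t)"
    and flow_\<iota>: "\<sigma> t (\<iota> a) = \<iota> a"
    and flow_V: "\<sigma> t (V i) = exp (\<i> * of_real t) *\<^sub>C V i"
  by (simp_all add: gauge_flow_def gauge_hom)

lemma flow_flow: "\<sigma> s (\<sigma> t x) = \<sigma> (s + t) x"
proof -
  have "\<sigma> s \<circ> \<sigma> t = \<sigma> (s + t)"
    by (intro unital_star_hom_eqI unital_star_hom_comp unital_star_hom_flow)
      (simp_all add: flow_\<iota> flow_V unital_star_homD(2)[OF unital_star_hom_flow] scaleC_scaleC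
        distrib_left exp_add mult.commute)
  then show ?thesis by (metis comp_apply)
qed

lemma flow_periodic: "\<sigma> (t + 2 * pi) = \<sigma> t"
  proof -
  have "exp (\<i> * (2 * complex_of_real pi)) = 1"
    by (simp only: exp_two_pi_i' mult.commute[of 2])
  then show ?thesis unfolding gauge_flow_def by (simp add: distrib_left exp_add)
qed

text \<open>The index is the degree under the gauge action. Sums are left to \<open>cspan\<close>,
  so that induction meets only generators and products.\<close>

inductive homog :: "int \<Rightarrow> 'b \<Rightarrow> bool" where
  homog_\<iota>: "homog 0 (\<iota> a)"
| homog_V: "homog 1 (V i)"
| homog_star_V: "homog (-1) (star (V i))"
| homog_mult: "homog m x \<Longrightarrow> homog n y \<Longrightarrow> homog (m + n) (x * y)"

lemma homog_star: "homog n x \<Longrightarrow> homog (- n) (star x)"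
proof (induction rule: homog.induct)
  case (homog_\<iota> a)
  show ?case using homog.homog_\<iota>[of "star a"] by (simp add: \<iota>_simps)
next
  case (homog_mult m x n y)
  then show ?case using homog.homog_mult[of "- n" "star y" "- m" "star x"]
    unfolding star_mult minus_add by simp
qed (auto simp: star_star intro: homog.intros)

lemma homog_one: "homog 0 1"
  using homog_\<iota>[of 1] by (simp add: \<iota>_simps)

lemma homog_word_prod: "homog (int (length \<mu>)) (word_prod V \<mu>)"
proof (induction \<mu>)
  case (Cons i \<mu>)
  then show ?case using homog_mult[OF homog_V[of i] Cons] by simp
qed (simp add: homog_one)

lemma flow_homog: "homog n x \<Longrightarrow> \<sigma> t x = exp (\<i> * of_int n * of_real t) *\<^sub>C x"
proof (induction rule: homog.induct)
  case (homog_mult m x n y)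
  then show ?case
    by (simp add: unital_star_homD(3)[OF unital_star_hom_flow] scaleC_mult_left scaleC_mult_right
        scaleC_scaleC algebra_simps exp_add)
qed (simp_all add: flow_\<iota> flow_V unital_star_homD(4)[OF unital_star_hom_flow] star_scaleC exp_cnj)

text \<open>The dense algebra that will witness the KMS condition; on it the flow has explicit
  entire extensions.\<close>

definition poly_alg :: "'b set" where
  "poly_alg = cspan {x. \<exists>n. homog n x}"

lemma star_subalgebra_poly_alg: "star_subalgebra poly_alg"
  unfolding poly_alg_def by (rule star_subalgebra_cspan) (auto intro: homog_mult homog_star)

lemma homog_in_poly_alg: "homog n x \<Longrightarrow> x \<in> poly_alg"
  unfolding poly_alg_def by (auto intro: cspan_base)

lemma closure_poly_alg: "closure poly_alg = UNIV"
proof (rule generating)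
  show "star_subalgebra (closure poly_alg)"
    by (rule star_subalgebra_closure[OF star_subalgebra_poly_alg])
qed (auto intro!: closure_subset[THEN subsetD] intro: homog_in_poly_alg homog.intros)

section \<open>Normally ordered monomials\<close>

definition monomials :: "'b set" where
  "monomials = {word_prod V \<mu> * \<iota> a * star (word_prod V \<nu>) |\<mu> a \<nu>. True}"

lemma monomialI: "word_prod V \<mu> * \<iota> a * star (word_prod V \<nu>) \<in> monomials"
  by (auto simp: monomials_def)

text \<open>\<open>fold\<close> starts at the head of the list, the letter that \<open>a\<close>
  meets first when it moves to the right.\<close>

lemma \<iota>_mult_word_prod: "\<iota> a * word_prod V \<mu> = word_prod V \<mu> * \<iota> (fold \<alpha> \<mu> a)"
proof (induction \<mu> arbitrary: a)
  case (Cons i \<mu>)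
  have "\<iota> a * word_prod V (i # \<mu>) = V i * (\<iota> (\<alpha> i a) * word_prod V \<mu>)"
    by (simp add: \<iota>_mult_V mult.assoc[symmetric])
  then show ?case by (simp add: Cons mult.assoc)
qed simp

lemma star_word_prod_mult_\<iota>: "star (word_prod V \<mu>) * \<iota> a = \<iota> (fold \<alpha> \<mu> a) * star (word_prod V \<mu>)"
proof (induction \<mu> arbitrary: a)
  case (Cons i \<mu>)
  have "star (word_prod V (i # \<mu>)) * \<iota> a = (star (word_prod V \<mu>) * \<iota> (\<alpha> i a)) * star (V i)"
    by (simp add: star_mult star_V_mult_\<iota> mult.assoc)
  then show ?case by (simp add: Cons star_mult mult.assoc)
qed simp

lemma star_V_mult_word_prod:
  "star (V i) * word_prod V (j # \<mu>) = (if i = j then word_prod V \<mu> else 0)"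
  by (simp add: star_V_mult_V flip: mult.assoc)

lemma star_word_prod_mult_V:
  "star (word_prod V (j # \<mu>)) * V i = (if i = j then star (word_prod V \<mu>) else 0)"
  by (simp add: star_mult star_V_mult_V mult.assoc)

text \<open>The two heads meet in the middle and cancel, pair by pair. With equal lengths no letter
  is left over, so the result is 0 or 1.\<close>

lemma star_word_prod_mult_word_prod:
  "length \<mu> = length \<nu> \<Longrightarrow> star (word_prod V \<mu>) * word_prod V \<nu> = (if \<mu> = \<nu> then 1 else 0)"
proof (induction \<mu> \<nu> rule: list_induct2)
  case (Cons i \<mu> j \<nu>)
  have "star (word_prod V (i # \<mu>)) * word_prod V (j # \<nu>) =
      star (word_prod V \<mu>) * (star (V i) * V j) * word_prod V \<nu>"
    by (simp add: star_mult mult.assoc)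
  then show ?case
    using Cons.IH by (cases "i = j"; cases "\<mu> = \<nu>") (simp_all add: star_V_mult_V)
qed simp

text \<open>The span of the monomials contains the unit and is stable under left multiplication by the
  generators.\<close>

lemma poly_alg_subset_span_monomials: "poly_alg \<subseteq> cspan monomials"
proof -
  have \<iota>: "\<iota> a * x \<in> cspan monomials" if x: "x \<in> monomials" for a x
  proof -
    obtain \<mu> b \<nu> where "x = word_prod V \<mu> * \<iota> b * star (word_prod V \<nu>)"
      using x by (auto simp: monomials_def)
    then have "\<iota> a * x = word_prod V \<mu> * \<iota> (fold \<alpha> \<mu> a * b) * star (word_prod V \<nu>)"
      by (simp add: \<iota>_mult_word_prod \<iota>_simps(3) mult.assoc[symmetric])
    then show ?thesis using monomialI cspan_base by metis
  qed
  have V: "V i * x \<in> cspan monomials" if x: "x \<in> monomials" for i x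
  proof -
    obtain \<mu> b \<nu> where "x = word_prod V \<mu> * \<iota> b * star (word_prod V \<nu>)"
      using x by (auto simp: monomials_def)
    then have "V i * x = word_prod V (i # \<mu>) * \<iota> b * star (word_prod V \<nu>)"
      by (simp add: mult.assoc)
    then show ?thesis using monomialI cspan_base by metis
  qed
  have star_V: "star (V i) * x \<in> cspan monomials" if x: "x \<in> monomials" for i x
  proof -
    obtain \<mu> b \<nu> where x_eq: "x = word_prod V \<mu> * \<iota> b * star (word_prod V \<nu>)"
      using x by (auto simp: monomials_def)
    show ?thesis
    proof (cases \<mu>)
      \<comment> \<open>With no letter to cancel, \<open>star (V i)\<close> moves past
        \<open>\<iota> b\<close> and joins the adjoint word, at the end of \<open>\<nu>\<close>
        because \<open>star\<close> reverses products.\<close>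
      case Nil
      then have "star (V i) * x = word_prod V [] * \<iota> (\<alpha> i b) * star (word_prod V (\<nu> @ [i]))"
        by (simp add: x_eq star_mult star_V_mult_\<iota> flip: mult.assoc)
      then show ?thesis using monomialI cspan_base by metis
    next
      case (Cons j \<mu>')
      then have "star (V i) * x =
          (if i = j then word_prod V \<mu>' * \<iota> b * star (word_prod V \<nu>) else 0)"
        using star_V_mult_word_prod[of i j \<mu>'] by (simp add: x_eq mult.assoc[symmetric] del: word_prod_simps)
      then show ?thesis using monomialI cspan_base cspan_zero by metis
    qed
  qed
  have "x * y \<in> cspan monomials" if "homog n x" "y \<in> cspan monomials" for n x y
    using that
  proof (induction arbitrary: y rule: homog.induct)
    case (homog_mult m x n y z)
    then show ?case by (simp add: mult.assoc)
  qed (auto intro: cspan_mult_left \<iota> V star_V)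
  moreover have "1 \<in> cspan monomials"
    using cspan_base[OF monomialI[of "[]" 1 "[]"]] by (simp add: \<iota>_simps(5))
  ultimately have homog: "x \<in> cspan monomials" if "homog n x" for n x
    using that by (metis mult_1_right)
  have "x \<in> cspan monomials" if "x \<in> poly_alg" for x
    using that unfolding poly_alg_def
    by (induction rule: cspan.induct) (auto intro: cspan_zero cspan_add cspan_scaleC homog)
  then show ?thesis by blast
qed

lemma closure_span_monomials: "closure (cspan monomials) = UNIV"
  using closure_mono[OF poly_alg_subset_span_monomials] closure_poly_alg by auto

subsection \<open>KMS states\<close>

text \<open>For \<open>y\<close> of degree \<open>n\<close> the weight cancels the phase of
  \<open>\<sigma> t y\<close>, so its coefficient is exactly \<open>2 * pi * \<phi> y\<close>. As
  the flow is contractive, replacing \<open>y\<close> by \<open>x\<close> costs at most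
  \<open>K * norm (x - y)\<close> at each \<open>t\<close>.\<close>

lemma norm_fourier_coefficient_diff_le:
  fixes \<phi> :: "'b \<Rightarrow> complex"
  assumes \<phi>: "bounded_linear \<phi>" "\<And>c x. \<phi> (c *\<^sub>C x) = c * \<phi> x" "\<And>x. cmod (\<phi> x) \<le> K * norm x"
    and x: "entire_extension \<sigma> x F" and y: "homog n y" and K: "K \<ge> 0"
  shows "cmod (integral {0..2*pi} (\<lambda>t. exp (- (\<i> * of_int n * of_real t)) * \<phi> (\<sigma> t x)) - 2 * pi * \<phi> y)
    \<le> 2 * pi * K * norm (x - y)"
proof -
  interpret bounded_linear \<phi> by fact
  let ?f = "\<lambda>t. exp (- (\<i> * of_int n * of_real t)) * \<phi> (\<sigma> t x)"
  have cont: "continuous_on {0..2*pi} ?f"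
    by (intro continuous_intros continuous_on_subset[OF continuous_on_functional_flow[OF \<phi>(1,2) x]]) auto
  have bound: "cmod (?f t - \<phi> y) \<le> K * norm (x - y)" for t
  proof -
    have "\<phi> y = exp (- (\<i> * of_int n * of_real t)) * \<phi> (\<sigma> t y)"
      by (simp add: flow_homog[OF y] \<phi>(2) flip: exp_add mult.assoc)
    then have "cmod (?f t - \<phi> y) = cmod (exp (- (\<i> * of_int n * of_real t)) * \<phi> (\<sigma> t (x - y)))"
      by (simp add: unital_star_hom_diff[OF unital_star_hom_flow] diff right_diff_distrib)
    also have "\<dots> = cmod (\<phi> (\<sigma> t (x - y)))" by (simp add: norm_mult)
    also have "\<dots> \<le> K * norm (\<sigma> t (x - y))" by (rule \<phi>(3))
    also have "\<dots> \<le> K * norm (x - y)"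
      by (intro mult_left_mono norm_unital_star_hom_le unital_star_hom_flow K)
    finally show ?thesis .
  qed
  have "integral {0..2*pi} ?f - 2 * pi * \<phi> y = integral {0..2*pi} (\<lambda>t. ?f t - \<phi> y)"
    by (subst integral_diff)
      (auto intro: integrable_continuous_real cont simp: scaleR_conv_of_real)
  also have "cmod \<dots> \<le> K * norm (x - y) * (2 * pi - 0)"
    by (rule integral_bound) (use bound cont in \<open>auto intro!: continuous_intros\<close>)
  finally show ?thesis by (simp add: mult_ac)
qed

text \<open>The dense algebra \<open>D\<close> of a KMS state need not contain any homogeneous elements. The KMS
  condition for the elements \<open>\<sigma>\<^sub>t x\<close> with \<open>x \<in> D\<close> is averaged against
  \<open>exp (-\<i> n t)\<close>, and \<open>x\<close> then tends to a homogeneous element.\<close>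

lemma kms_state_fourier:
  assumes \<psi>: "state \<psi>"
    and D: "D \<subseteq> analytic_elements \<sigma>" "\<And>t x. x \<in> D \<Longrightarrow> \<sigma> t x \<in> D"
    and kms: "\<And>x. x \<in> D \<Longrightarrow> \<psi> (x * y) = \<psi> (y * complex_flow \<sigma> (\<i> * of_real \<beta>) x)"
    and x: "x \<in> D"
  shows "integral {0..2*pi} (\<lambda>t. exp (- (\<i> * of_int n * of_real t)) * \<psi> (\<sigma> t x * y)) =
    exp (- of_int n * of_real \<beta>) * integral {0..2*pi} (\<lambda>t. exp (- (\<i> * of_int n * of_real t)) * \<psi> (y * \<sigma> t x))"
proof -
  define F where "F z = complex_flow \<sigma> z x" for z
  have F: "entire_extension \<sigma> x F"
    unfolding F_def using x D(1) by (auto intro: entire_extension_complex_flow)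
  define g where "g z = \<psi> (y * F z)" for z
  note \<phi> = bounded_linear_state_mult(2)[OF \<psi>, of y] state_mult_scaleC(2)[OF \<psi>, of y]
  have g: "g holomorphic_on UNIV"
    unfolding g_def using F by (intro holomorphic_functional_entire \<phi>) (simp add: entire_extension_def)
  have g_real: "g (of_real t) = \<psi> (y * \<sigma> t x)" for t
    using F by (simp add: g_def entire_extension_def)
  \<comment> \<open>By the group law and the identity theorem, the functional sees the extension of
    the orbit of \<open>\<sigma> t x\<close> as the translate of \<open>g\<close> by
    \<open>t\<close>. Invariance of \<open>D\<close> allows the KMS condition at
    \<open>\<sigma> t x\<close>.\<close>
  have shift: "\<psi> (\<sigma> t x * y) = g (of_real t + \<i> * of_real \<beta>)" for t
  proof -
    define G where "G z = complex_flow \<sigma> z (\<sigma> t x)" for z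
    have G: "entire_extension \<sigma> (\<sigma> t x) G"
      unfolding G_def using x D by (auto intro: entire_extension_complex_flow)
    have shift: "(\<lambda>z. g (of_real t + z)) holomorphic_on UNIV"
    proof -
      have "(\<lambda>z. of_real t + z) holomorphic_on UNIV" by (intro holomorphic_intros)
      from holomorphic_on_compose[OF this, of g] holomorphic_on_subset[OF g]
      show ?thesis by (simp add: o_def)
    qed
    have "\<psi> (y * G (of_real s)) = g (of_real t + of_real s)" for s
      using G g_real[of "t + s"] by (simp add: entire_extension_def flow_flow add.commute)
    moreover have "(\<lambda>z. \<psi> (y * G z)) holomorphic_on UNIV"
      using G by (intro holomorphic_functional_entire \<phi>) (simp add: entire_extension_def)
    ultimately have "\<psi> (y * G z) = g (of_real t + z)" for z
      using holomorphic_eq_of_real[OF _ shift] by blast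
    then show ?thesis using kms[of "\<sigma> t x"] x D(2) by (simp add: G_def)
  qed
  have "g (of_real (t + 2 * pi)) = g (of_real t)" for t
    by (simp only: g_real flow_periodic)
  from fourier_coefficient_shift[OF g this, of n \<beta>] show ?thesis
    by (simp only: shift g_real)
qed

text \<open>The averaged identity over \<open>D\<close> gives the claim for \<open>w\<close> up to
  an error proportional to \<open>norm (x - w)\<close>, which density removes. A second use of
  density frees \<open>y\<close> from \<open>D\<close>.\<close>

lemma kms_state_homog:
  assumes "kms_state \<sigma> \<beta> \<psi>" and w: "homog n w"
  shows "\<psi> (w * y) = exp (- of_int n * of_real \<beta>) * \<psi> (y * w)"
proof -
  have \<psi>: "state \<psi>" using assms(1) by (simp add: kms_state_def)
  obtain D where D: "closure D = UNIV" "D \<subseteq> analytic_elements \<sigma>" "\<And>t x. x \<in> D \<Longrightarrow> \<sigma> t x \<in> D"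
    and kms: "\<And>x y. x \<in> D \<Longrightarrow> y \<in> D \<Longrightarrow> \<psi> (x * y) = \<psi> (y * complex_flow \<sigma> (\<i> * of_real \<beta>) x)"
    using assms(1) unfolding kms_state_def by metis
  let ?e = "exp (- of_int n * of_real \<beta>) :: complex"
  have "\<psi> (w * y) = ?e * \<psi> (y * w)" if y: "y \<in> D" for y
  proof -
    let ?C = "2 * pi * norm y * (1 + cmod ?e)"
    let ?d = "2 * pi * (\<psi> (w * y) - ?e * \<psi> (y * w))"
    have bound: "cmod ?d \<le> ?C * norm (x - w)" if x: "x \<in> D" for x
    proof -
      obtain F where F: "entire_extension \<sigma> x F" using x D(2) by (auto simp: analytic_elements_def)
      let ?I = "integral {0..2*pi} (\<lambda>t. exp (- (\<i> * of_int n * of_real t)) * \<psi> (\<sigma> t x * y))"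
      let ?J = "integral {0..2*pi} (\<lambda>t. exp (- (\<i> * of_int n * of_real t)) * \<psi> (y * \<sigma> t x))"
      have IJ: "?I = ?e * ?J" by (rule kms_state_fourier[OF \<psi> D(2,3) kms[OF _ y] x])
      have I: "cmod (?I - 2 * pi * \<psi> (w * y)) \<le> 2 * pi * norm y * norm (x - w)"
        by (rule norm_fourier_coefficient_diff_le[OF bounded_linear_state_mult(1)[OF \<psi>]
              state_mult_scaleC(1)[OF \<psi>] norm_state_mult_le(1)[OF \<psi>] F w]) simp
      have J: "cmod (?J - 2 * pi * \<psi> (y * w)) \<le> 2 * pi * norm y * norm (x - w)"
        by (rule norm_fourier_coefficient_diff_le[OF bounded_linear_state_mult(2)[OF \<psi>]
              state_mult_scaleC(2)[OF \<psi>] norm_state_mult_le(2)[OF \<psi>] F w]) simp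
      \<comment> \<open>Since \<open>?I = ?e * ?J\<close>, the integrals cancel and only the two
        approximation errors remain.\<close>
      have "?d = ?e * (?J - 2 * pi * \<psi> (y * w)) - (?I - 2 * pi * \<psi> (w * y))"
        unfolding right_diff_distrib IJ[symmetric] by (simp only: algebra_simps)
      then have "cmod ?d \<le> cmod ?e * cmod (?J - 2 * pi * \<psi> (y * w)) + cmod (?I - 2 * pi * \<psi> (w * y))"
        by (simp only: norm_triangle_ineq4 flip: norm_mult)
      also have "\<dots> \<le> cmod ?e * (2 * pi * norm y * norm (x - w)) + 2 * pi * norm y * norm (x - w)"
        by (intro add_mono mult_left_mono I J) simp
      finally show ?thesis by (simp add: algebra_simps)
    qed
    \<comment> \<open>The estimate persists on the closure of \<open>D\<close>, hence at
      \<open>x = w\<close>, where its right-hand side is 0.\<close>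
    have "D \<subseteq> {x. cmod ?d \<le> ?C * norm (x - w)}" using bound by blast
    moreover have "closed {x. cmod ?d \<le> ?C * norm (x - w)}"
      by (intro closed_Collect_le continuous_intros)
    ultimately have "w \<in> {x. cmod ?d \<le> ?C * norm (x - w)}" using D(1) closure_minimal by blast
    then show ?thesis by simp
  qed
  then have "D \<subseteq> {y. \<psi> (w * y) = ?e * \<psi> (y * w)}" by blast
  moreover have "closed {y. \<psi> (w * y) = ?e * \<psi> (y * w)}"
    by (intro closed_Collect_eq continuous_intros linear_continuous_on bounded_linear_state_mult[OF \<psi>])
  ultimately show ?thesis using D(1) closure_minimal by blast
qed

text \<open>Degree 0 makes the exponential factor equal to 1.\<close>

lemma kms_state_trace:
  assumes "kms_state \<sigma> \<beta> \<psi>"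
  shows "tracial (\<lambda>a. \<psi> (\<iota> a))"
  unfolding tracial_def \<iota>_simps(3)
proof (intro allI)
  show "\<psi> (\<iota> a * \<iota> b) = \<psi> (\<iota> b * \<iota> a)" for a b
    using kms_state_homog[OF assms homog_\<iota>, of a "\<iota> b"] by simp
qed

lemma kms_state_monomial:
  assumes kms: "kms_state \<sigma> \<beta> \<psi>" and "\<beta> > 0"
  shows "\<psi> (word_prod V \<mu> * \<iota> a * star (word_prod V \<nu>)) =
    (if \<mu> = \<nu> then complex_of_real (exp (- real (length \<mu>) * \<beta>)) * \<psi> (\<iota> a) else 0)"
proof (cases "length \<mu> = length \<nu>")
  case True
  have \<psi>: "state \<psi>" using kms by (simp add: kms_state_def)
  have "\<psi> (word_prod V \<mu> * (\<iota> a * star (word_prod V \<nu>))) =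
      exp (- of_int (int (length \<mu>)) * of_real \<beta>) * \<psi> (\<iota> a * star (word_prod V \<nu>) * word_prod V \<mu>)"
    by (rule kms_state_homog[OF kms homog_word_prod])
  then show ?thesis
    using star_word_prod_mult_word_prod[OF True[symmetric]]
    by (auto simp: mult.assoc state_zero[OF \<psi>] simp flip: exp_of_real)
next
  case False
  let ?n = "int (length \<mu>) + 0 + - int (length \<nu>)"
  let ?w = "word_prod V \<mu> * \<iota> a * star (word_prod V \<nu>)"
  have "homog ?n ?w"
    by (intro homog_mult homog_word_prod homog_\<iota> homog_star)
  from kms_state_homog[OF kms this, of 1]
  have "\<psi> ?w = exp (- of_int ?n * of_real \<beta>) * \<psi> ?w" by simp
  also have "exp (- of_int ?n * complex_of_real \<beta>) = of_real (exp (- of_int ?n * \<beta>))"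
    by (simp flip: exp_of_real)
  finally have "\<psi> ?w = of_real (exp (- of_int ?n * \<beta>)) * \<psi> ?w" .
  \<comment> \<open>Here \<open>\<beta> > 0\<close> enters: the exponent is nonzero because the
    lengths differ.\<close>
  moreover have "exp (- of_int ?n * \<beta>) \<noteq> 1" using False \<open>\<beta> > 0\<close> by simp
  ultimately have "\<psi> ?w = 0"
    by (metis mult_cancel_right2 of_real_eq_1_iff)
  with False show ?thesis by auto
qed

lemma kms_state_ge:
  assumes kms: "kms_state \<sigma> \<beta> \<psi>"
  shows "ln (real CARD('d)) \<le> \<beta>"
proof -
  have \<psi>: "state \<psi>" using kms by (simp add: kms_state_def)
  have range_proj: "\<psi> (V i * star (V i)) = of_real (exp (- \<beta>))" for i
    using kms_state_homog[OF kms homog_V, of i "star (V i)"]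
    by (simp add: star_V_mult_V stateD(5)[OF \<psi>] flip: exp_of_real)
  have sum: "\<psi> (\<Sum>i\<in>A. f i) = (\<Sum>i\<in>A. \<psi> (f i))" for A and f :: "'d \<Rightarrow> 'b"
    by (rule linear_sum[OF bounded_linear.linear[OF bounded_linear_state[OF \<psi>]]])
  \<comment> \<open>Orthogonality of the range projections makes \<open>q\<close> a projection, so
    \<open>1 - q\<close> equals \<open>star (1 - q) * (1 - q)\<close> and its value under
    \<open>\<psi>\<close>, which is \<open>1 - CARD('d) * exp (- \<beta>)\<close>, is
    nonnegative.\<close>
  define q where "q = (\<Sum>i\<in>UNIV. V i * star (V i))"
  have star_q: "star q = q"
    unfolding q_def linear_sum[OF bounded_linear.linear[OF bounded_linear_star]]
    by (simp add: star_mult star_star)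
  have "V i * star (V i) * (V j * star (V j)) = (if i = j then V i * star (V i) else 0)" for i j
  proof -
    have "V i * star (V i) * (V j * star (V j)) = V i * (star (V i) * V j) * star (V j)"
      by (simp add: mult.assoc)
    then show ?thesis by (simp add: star_V_mult_V)
  qed
  then have "q * q = q" by (simp add: q_def sum_product)
  then have "star (1 - q) * (1 - q) = 1 - q" by (simp add: star_diff star_q algebra_simps)
  then have "0 \<le> Re (\<psi> (1 - q))" using stateD(4)[OF \<psi>, of "1 - q"] by simp
  also have "\<psi> (1 - q) = of_real (1 - real CARD('d) * exp (- \<beta>))"
    by (simp add: q_def state_diff[OF \<psi>] stateD(5)[OF \<psi>] sum range_proj)
  finally have "real CARD('d) \<le> exp \<beta>" by (simp add: exp_minus field_simps)
  then have "ln (real CARD('d)) \<le> ln (exp \<beta>)" by (subst ln_le_cancel_iff) auto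
  then show ?thesis by simp
qed

section \<open>From the monomial formula to the KMS condition\<close>

text \<open>The relation \<open>\<psi> (x y) = exp (-n \<beta>) \<psi> (y x)\<close> for all \<open>y\<close> is inherited by products and adjoints,
  so only the generators have to be compared with monomials.\<close>

lemma homog_kms:
  assumes \<psi>: "state \<psi>" and tr: "tracial (\<lambda>a. \<psi> (\<iota> a))"
    and mon: "\<And>a \<mu> \<nu>. \<psi> (word_prod V \<mu> * \<iota> a * star (word_prod V \<nu>)) =
      (if \<mu> = \<nu> then complex_of_real (exp (- real (length \<mu>) * \<beta>)) * \<psi> (\<iota> a) else 0)"
  shows "homog n x \<Longrightarrow> \<psi> (x * y) = exp (- of_int n * of_real \<beta>) * \<psi> (y * x)"
proof -
  \<comment> \<open>Both sides are linear and continuous in \<open>y\<close>, and the monomials span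
    a dense subspace.\<close>
  have dense: "\<psi> (x * y) = c * \<psi> (y * x)" if eq: "\<And>y. y \<in> monomials \<Longrightarrow> \<psi> (x * y) = c * \<psi> (y * x)" for x y c
  proof -
    have "\<psi> (x * y) = c * \<psi> (y * x)" if "y \<in> cspan monomials" for y
      using that
    proof (induction rule: cspan.induct)
      case (cspan_step y y' b)
      then show ?case
        by (simp add: distrib_left distrib_right stateD[OF \<psi>] scaleC_mult_left scaleC_mult_right
            eq[OF cspan_step.hyps(1)] algebra_simps)
    qed (simp add: state_zero[OF \<psi>])
    then have "cspan monomials \<subseteq> {y. \<psi> (x * y) = c * \<psi> (y * x)}" by blast
    moreover have "closed {y. \<psi> (x * y) = c * \<psi> (y * x)}"
      by (intro closed_Collect_eq continuous_intros linear_continuous_on bounded_linear_state_mult[OF \<psi>])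
    ultimately show ?thesis using closure_span_monomials closure_minimal by blast
  qed
  have V: "\<psi> (V i * y) = exp (- of_real \<beta>) * \<psi> (y * V i)" for i y
  proof (rule dense)
    fix y assume "y \<in> monomials"
    then obtain \<mu> a \<nu> where y: "y = word_prod V \<mu> * \<iota> a * star (word_prod V \<nu>)"
      by (auto simp: monomials_def)
    have left: "V i * y = word_prod V (i # \<mu>) * \<iota> a * star (word_prod V \<nu>)" by (simp add: y mult.assoc)
    show "\<psi> (V i * y) = exp (- of_real \<beta>) * \<psi> (y * V i)"
    proof (cases \<nu>)
      \<comment> \<open>Both sides are 0: \<open>i # \<mu>\<close> and \<open>\<mu> @ [i]\<close>
        are nonempty, while the adjoint words are empty.\<close>
      case Nil
      then have right: "y * V i = word_prod V (\<mu> @ [i]) * \<iota> (\<alpha> i a) * star (word_prod V [])"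
        by (simp add: y mult.assoc \<iota>_mult_V)
      show ?thesis unfolding left right mon using Nil by simp
    next
      case (Cons j \<nu>')
      then have right: "y * V i = (if i = j then word_prod V \<mu> * \<iota> a * star (word_prod V \<nu>') else 0)"
        using star_word_prod_mult_V[of j \<nu>' i] by (simp add: y mult.assoc del: word_prod_simps)
      \<comment> \<open>After cancellation both sides carry the condition
        \<open>i # \<mu> = \<nu>\<close>; the left word is one letter longer, whence the factor
        \<open>exp (- \<beta>)\<close>.\<close>
      have "\<psi> (y * V i) = (if i # \<mu> = \<nu> then of_real (exp (- real (length \<mu>) * \<beta>)) * \<psi> (\<iota> a) else 0)"
        unfolding right using Cons by (simp only: if_distrib[of \<psi>] mon state_zero[OF \<psi>]) auto
      moreover have "exp (- real (length (i # \<mu>)) * \<beta>) = exp (- \<beta>) * exp (- real (length \<mu>) * \<beta>)"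
        by (simp add: algebra_simps flip: exp_add)
      ultimately show ?thesis
        unfolding left mon by (simp only: exp_of_real[symmetric] of_real_mult of_real_minus) simp
    qed
  qed
  show "\<psi> (x * y) = exp (- of_int n * of_real \<beta>) * \<psi> (y * x)" if "homog n x"
    using that
  proof (induction arbitrary: y rule: homog.induct)
    case (homog_\<iota> a)
    show ?case
    proof (rule dense)
      fix y assume "y \<in> monomials"
      then obtain \<mu> b \<nu> where y: "y = word_prod V \<mu> * \<iota> b * star (word_prod V \<nu>)"
        by (auto simp: monomials_def)
      have left: "\<iota> a * y = word_prod V \<mu> * \<iota> (fold \<alpha> \<mu> a * b) * star (word_prod V \<nu>)"
        by (simp add: y \<iota>_simps(3) \<iota>_mult_word_prod flip: mult.assoc)
      have right: "y * \<iota> a = word_prod V \<mu> * \<iota> (b * fold \<alpha> \<nu> a) * star (word_prod V \<nu>)"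
        by (simp add: y \<iota>_simps(3) star_word_prod_mult_\<iota> mult.assoc)
      \<comment> \<open>Only \<open>\<mu> = \<nu>\<close> contributes, and then the same element
        \<open>fold \<alpha> \<mu> a\<close> stands before and after \<open>b\<close>, so the trace
        property applies.\<close>
      show "\<psi> (\<iota> a * y) = exp (- of_int 0 * of_real \<beta>) * \<psi> (y * \<iota> a)"
        unfolding left right mon using tr by (simp add: tracial_def)
    qed
  next
    case (homog_V i)
    show ?case by (simp add: V)
  next
    case (homog_star_V i)
    \<comment> \<open>The identity for \<open>V i\<close> is applied to \<open>star y\<close>,
      solved for its other side and conjugated; this inverts the factor, as degree -1
      requires.\<close>
    have "\<psi> (star (V i) * y) = cnj (\<psi> (star y * V i))"
      by (simp add: star_mult star_star flip: state_star[OF \<psi>])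
    also have "\<psi> (star y * V i) = exp (of_real \<beta>) * \<psi> (V i * star y)"
      by (simp add: V exp_minus)
    also have "cnj \<dots> = exp (of_real \<beta>) * \<psi> (y * star (V i))"
      by (simp add: star_mult star_star exp_cnj flip: state_star[OF \<psi>])
    finally show ?case by simp
  next
    case (homog_mult m x n z)
    have exp: "exp (- of_int (m + n) * of_real \<beta>) =
        exp (- of_int m * of_real \<beta>) * exp (- of_int n * complex_of_real \<beta>)"
      by (simp add: algebra_simps flip: exp_add)
    \<comment> \<open>The two factors move to the right end one after the other, with
      \<open>z * y\<close> and then \<open>y * x\<close> in place of \<open>y\<close>.\<close>
    have "\<psi> (x * z * y) = exp (- of_int m * of_real \<beta>) * \<psi> (z * (y * x))"
      using homog_mult.IH(1)[of "z * y"] by (simp add: mult.assoc)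
    also have "\<psi> (z * (y * x)) = exp (- of_int n * of_real \<beta>) * \<psi> (y * (x * z))"
      using homog_mult.IH(2)[of "y * x"] by (simp add: mult.assoc)
    finally show ?case by (simp only: exp mult.assoc)
  qed
qed

text \<open>A homogeneous \<open>x\<close> of degree \<open>n\<close> has the extension
  \<open>exp (\<i> * n * z) *\<^sub>C x\<close>, whose value at \<open>\<i> * \<beta>\<close> is
  \<open>exp (- n * \<beta>) *\<^sub>C x\<close>; so the KMS condition on \<open>poly_alg\<close> is
  the linear extension of the hypothesis.\<close>

lemma kms_stateI:
  assumes \<psi>: "state \<psi>"
    and hom: "\<And>n x y. homog n x \<Longrightarrow> \<psi> (x * y) = exp (- of_int n * of_real \<beta>) * \<psi> (y * x)"
  shows "kms_state \<sigma> \<beta> \<psi>"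
proof -
  \<comment> \<open>The identity is proved for an explicit extension \<open>F\<close> first; the one
    chosen by \<open>complex_flow\<close> is compared with \<open>F\<close> afterwards, under the
    functional alone.\<close>
  have ext: "\<exists>F. entire_extension \<sigma> x F \<and> (\<forall>y. \<psi> (x * y) = \<psi> (y * F (\<i> * of_real \<beta>)))"
    if "x \<in> poly_alg" for x
    using that unfolding poly_alg_def
  proof (induction rule: cspan.induct)
    case cspan_zero
    have "\<sigma> t 0 = 0" for t using unital_star_hom_diff[OF unital_star_hom_flow, of t 0 0] by simp
    moreover have "entire (\<lambda>z. 0 :: 'b)" using entire_scaleC[of "\<lambda>_. 0" 0] by simp
    ultimately show ?case by (intro exI[of _ "\<lambda>_. 0"]) (simp add: entire_extension_def)
  next
    case (cspan_step x x' c)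
    then obtain n F where x: "homog n x" and F: "entire_extension \<sigma> x' F"
        "\<And>y. \<psi> (x' * y) = \<psi> (y * F (\<i> * of_real \<beta>))"
      by blast
    define G where "G z = (c * exp (\<i> * of_int n * z)) *\<^sub>C x + F z" for z
    have "entire G"
      unfolding G_def using F(1)
      by (intro entire_add entire_scaleC holomorphic_intros) (simp_all add: entire_extension_def)
    moreover have "G (of_real t) = \<sigma> t (c *\<^sub>C x + x')" for t
      using F(1) flow_homog[OF x]
      by (simp add: G_def entire_extension_def unital_star_homD[OF unital_star_hom_flow] scaleC_scaleC)
    moreover have "\<psi> ((c *\<^sub>C x + x') * y) = \<psi> (y * G (\<i> * of_real \<beta>))" for y
      by (simp add: G_def distrib_left distrib_right stateD[OF \<psi>] scaleC_mult_left scaleC_mult_right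
          F(2) hom[OF x] algebra_simps)
    ultimately show ?case by (auto simp: entire_extension_def)
  qed
  have analytic: "poly_alg \<subseteq> analytic_elements \<sigma>" using ext by (auto simp: analytic_elements_def)
  have flow: "\<sigma> t x \<in> poly_alg" if "x \<in> poly_alg" for t x
    using that unfolding poly_alg_def
  proof (induction rule: cspan.induct)
    case cspan_zero
    show ?case
      using unital_star_hom_diff[OF unital_star_hom_flow, of t 0 0] by (simp add: cspan.cspan_zero)
  next
    case (cspan_step x x' c)
    then obtain n where "homog n x" by blast
    then have flow: "\<sigma> t (c *\<^sub>C x + x') = (c * exp (\<i> * of_int n * of_real t)) *\<^sub>C x + \<sigma> t x'"
      by (simp add: unital_star_homD[OF unital_star_hom_flow] flow_homog scaleC_scaleC)
    show ?case
      unfolding flow by (rule cspan.cspan_step[OF cspan_step.hyps(1) cspan_step.IH])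
  qed
  have kms: "\<psi> (x * y) = \<psi> (y * complex_flow \<sigma> (\<i> * of_real \<beta>) x)" if x: "x \<in> poly_alg" for x y
  proof -
    obtain F where F: "entire_extension \<sigma> x F" "\<psi> (x * y) = \<psi> (y * F (\<i> * of_real \<beta>))"
      using ext[OF x] by blast
    have "entire_extension \<sigma> x (\<lambda>z. complex_flow \<sigma> z x)"
      using x analytic by (auto intro: entire_extension_complex_flow)
    from entire_extension_functional_eq[OF bounded_linear_state_mult(2)[OF \<psi>, of y]
        state_mult_scaleC(2)[OF \<psi>, of y] F(1) this]
    show ?thesis using F(2) by simp
  qed
  show ?thesis
    unfolding kms_state_def
  proof (rule conjI[OF \<psi>], rule exI[of _ poly_alg], intro conjI)
    show "\<forall>t. \<forall>x\<in>poly_alg. \<sigma> t x \<in> poly_alg" using flow by blast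
    show "\<forall>x\<in>poly_alg. \<forall>y\<in>poly_alg. \<psi> (x * y) = \<psi> (y * complex_flow \<sigma> (\<i> * of_real \<beta>) x)"
      using kms by blast
  qed (rule star_subalgebra_poly_alg closure_poly_alg analytic)+
qed

end

theorem proposition3p1:
  fixes \<alpha> :: "'d::finite \<Rightarrow> 'a::cstar_algebra \<Rightarrow> 'a"
    and \<iota> :: "'a \<Rightarrow> 'b::cstar_algebra"
    and V :: "'d \<Rightarrow> 'b"
    and \<beta> :: real
  assumes "cstar_dynamical_system \<alpha>"
    and "toeplitz_pimsner \<alpha> \<iota> V"
  shows "(\<beta> < ln (real CARD('d)) \<longrightarrow>
            \<not> (\<exists>\<psi>. kms_state (gauge_flow \<iota> V) \<beta> \<psi>)) \<and>
         (\<beta> \<ge> ln (real CARD('d)) \<and> \<beta> > 0 \<longrightarrow>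
            (\<forall>\<psi>. state \<psi> \<longrightarrow>
               (kms_state (gauge_flow \<iota> V) \<beta> \<psi> \<longleftrightarrow>
                  tracial (\<lambda>a. \<psi> (\<iota> a)) \<and>
                  (\<forall>a \<mu> \<nu>. \<psi> (word_prod V \<mu> * \<iota> a * star (word_prod V \<nu>)) =
                     (if \<mu> = \<nu> then complex_of_real (exp (- real (length \<mu>) * \<beta>)) * \<psi> (\<iota> a) else 0)))))"
proof -
  interpret toeplitz_algebra \<alpha> \<iota> V by unfold_locales fact+
  show ?thesis
  proof (intro conjI impI allI iffI notI)
    assume "\<beta> < ln (real CARD('d))" "\<exists>\<psi>. kms_state (gauge_flow \<iota> V) \<beta> \<psi>"
    then show False using kms_state_ge by fastforce
  next
    fix \<psi> :: "'b \<Rightarrow> complex"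
    assume "state \<psi>" "tracial (\<lambda>a. \<psi> (\<iota> a)) \<and>
      (\<forall>a \<mu> \<nu>. \<psi> (word_prod V \<mu> * \<iota> a * star (word_prod V \<nu>)) =
        (if \<mu> = \<nu> then complex_of_real (exp (- real (length \<mu>) * \<beta>)) * \<psi> (\<iota> a) else 0))"
    then show "kms_state (gauge_flow \<iota> V) \<beta> \<psi>" by (intro kms_stateI homog_kms) blast+
  qed (simp_all add: kms_state_trace kms_state_monomial)
qed

end
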